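(* Let $k$ be a complete valuation field, and let $\lambda_k$ denote the successor cardinal of $\max\{\#(k/O_k),\aleph_0\}$, where $O_k=\{c\in k : |c|\le 1\}$ and $k/O_k$ is the quotient of additive groups. Let $V$ be a Banach $k$-vector space with $\#V=\mathrm{rank}(V)$. If the cardinal $\mathrm{rank}(V)$ is $\lambda_k$-strongly compact, then the following are equivalent: (1) $V$ is free. (2) $V$ is almost free.
   Context: $\#X$ denotes the cardinality of the underlying set of $X$. A complete valuation field is a field $k$ with a map $|\cdot|:k\to\mathbb{R}_{\ge 0}$ such that $|c|=0$ iff $c=0$, $|c_0-c_1|\le\max\{|c_0|,|c_1|\}$, $|c_0c_1|=|c_0||c_1|$, and $k$ is complete for the ultrametric $|c_0-c_1|$ (the trivial valuation is allowed). A Banach $k$-vector space is a $k$-vector space $V$ with a map $\|\cdot\|:V\to\mathbb{R}_{\ge 0}$ such that $\|v\|=0$ iff $v=0$, $\|v_0-v_1\|\le\max\{\|v_0\|,\|v_1\|\}$, $\|cv\|=|c|\|v\|$, and $V$ is complete for the ultrametric $\|v_0-v_1\|$. Closed $k$-linear subspaces carry the restricted norm and are Banach $k$-vector spaces. For a set $E$, $C_0(E,k)$ is the Banach $k$-vector space of maps $c:E\to k$ such that $\{e\in E:|c(e)|\ge\epsilon\}$ is finite for every $\epsilon>0$, with the norm $\|c\|=\sup_{e\in E}|c(e)|$ (equal to $0$ if $E=\emptyset$). An orthonormal Schauder basis of $V$ is a subset $E\subset V$ such that $\|e\|=1$ for all $e\in E$; $\|\sum_{e\in E}c(e)e\|=\|c\|$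 for all $c\in C_0(E,k)$; and every $v\in V$ equals $\sum_{e\in E}c(e)e$ for some $c\in C_0(E,k)$ (the sums being the usual limits of finite sums). For $S\subset V$, $\langle S\rangle$ is the closure of the $k$-linear span of $S$. $\mathrm{rank}(V)$ is the minimum cardinality of a subset $S\subset V$ with $V=\langle S\rangle$. $V$ is free if it admits an orthonormal Schauder basis; for a cardinal $\kappa$, $V$ is $\kappa$-free if every closed subspace of the form $\langle S\rangle$ with $S\subset V$, $\#S<\kappa$, is free; $V$ is almost free if it is $\mathrm{rank}(V)$-free. A filter $\mathcal{F}$ is $\lambda$-complete, for a cardinal $\lambda$, if the intersection of every non-empty subfamily of $\mathcal{F}$ of cardinality $<\lambda$ belongs to $\mathcal{F}$. For an uncountable cardinal $\lambda$, a cardinal $\kappa$ is $\lambda$-strongly compact if $\kappa\ge\lambda$ and for every $\kappa$-complete filter $\mathcal{F}$ on $\kappa$ there exists a $\lambda$-complete ultrafilter on $\kappa$ containing $\mathcal{F}$. *)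

theory Defs
  imports "HOL-Analysis.Analysis"
begin

unbundle cardinal_syntax

text \<open>
  A cardinal is a cardinal order, as usual for the cardinals of HOL. The two arguments below may
  live on different types, hence the embedding into a sum type.
\<close>

definition card_max :: "'a rel \<Rightarrow> 'b rel \<Rightarrow> ('a + 'b) rel" where
  "card_max r s = (if r \<le>o s then |Inr ` Field s :: ('a + 'b) set| else |Inl ` Field r| )"

lemma card_max_absorb:
  assumes "Card_order r" "Card_order s"
  shows card_max_absorb2: "r \<le>o s \<Longrightarrow> card_max r s =o s"
    and card_max_absorb1: "s \<le>o r \<Longrightarrow> card_max r s =o r"
proof -
  have l: "|Inl ` Field r :: ('a + 'b) set| =o r"
  proof -
    have "bij_betw Inl (Field r) (Inl ` Field r :: ('a + 'b) set)"
      by (simp add: bij_betw_def)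
    from ordIso_symmetric[OF card_of_ordIsoI[OF this]] show ?thesis
      using card_of_Field_ordIso[OF assms(1)] by (rule ordIso_transitive)
  qed
  have r: "|Inr ` Field s :: ('a + 'b) set| =o s"
  proof -
    have "bij_betw Inr (Field s) (Inr ` Field s :: ('a + 'b) set)"
      by (simp add: bij_betw_def)
    from ordIso_symmetric[OF card_of_ordIsoI[OF this]] show ?thesis
      using card_of_Field_ordIso[OF assms(2)] by (rule ordIso_transitive)
  qed
  show "r \<le>o s \<Longrightarrow> card_max r s =o s"
    using r by (simp add: card_max_def)
  show "card_max r s =o r" if sr: "s \<le>o r"
  proof (cases "r \<le>o s")
    case True
    then have "s =o r"
      using sr by (simp add: ordIso_iff_ordLeq)
    with r have "|Inr ` Field s :: ('a + 'b) set| =o r"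
      by (rule ordIso_transitive)
    with True show ?thesis
      by (simp add: card_max_def)
  next
    case False
    with l show ?thesis
      by (simp add: card_max_def)
  qed
qed

lemma Card_order_card_max: "Card_order (card_max r s)"
  by (simp add: card_max_def card_of_Card_order)

text \<open>
  A filter on a set \<open>X\<close> is given by the filter it generates on the whole type, so its members are
  the sets \<open>A\<close> with \<open>\<forall>\<^sub>F x in F. x \<in> A\<close>. Filters are understood to be proper, whereas the type
  of filters also contains the improper filter \<open>bot\<close>. The order on that type is the reverse
  of inclusion: \<open>U \<le> F\<close> says that \<open>U\<close> contains \<open>F\<close>.
\<close>

definition proper_filter_on :: "'a set \<Rightarrow> 'a filter \<Rightarrow> bool" where
  "proper_filter_on X F \<longleftrightarrow> F \<noteq> bot \<and> F \<le> principal X"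

definition ultrafilter_on :: "'a set \<Rightarrow> 'a filter \<Rightarrow> bool" where
  "ultrafilter_on X U \<longleftrightarrow> proper_filter_on X U \<and>
     (\<forall>A\<subseteq>X. (\<forall>\<^sub>F x in U. x \<in> A) \<or> (\<forall>\<^sub>F x in U. x \<in> X - A))"

definition complete_filter :: "'b rel \<Rightarrow> 'a filter \<Rightarrow> bool" where
  "complete_filter \<mu> F \<longleftrightarrow>
     (\<forall>\<A>. \<A> \<noteq> {} \<and> |\<A>| <o \<mu> \<and> (\<forall>A\<in>\<A>. \<forall>\<^sub>F x in F. x \<in> A) \<longrightarrow> (\<forall>\<^sub>F x in F. x \<in> \<Inter>\<A>))"

definition strongly_compact :: "'b rel \<Rightarrow> 'a rel \<Rightarrow> bool" where
  "strongly_compact \<mu> \<kappa> \<longleftrightarrow>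
     Card_order \<mu> \<and> natLeq <o \<mu> \<and> Card_order \<kappa> \<and> \<mu> \<le>o \<kappa> \<and>
     (\<forall>F. proper_filter_on (Field \<kappa>) F \<and> complete_filter \<kappa> F \<longrightarrow>
       (\<exists>U. ultrafilter_on (Field \<kappa>) U \<and> complete_filter \<mu> U \<and> U \<le> F))"

text \<open>
  The metric of \<^class>\<open>complete_space\<close> is tied to the valuation by \<open>dist_val\<close>, which determines the
  topology and the uniformity. That \<open>val\<close> is nonnegative and vanishes only at \<open>0\<close> is part of
  \<open>dist\<close> being a metric.
\<close>

class complete_valuation_field = field + complete_space +
  fixes val :: "'a \<Rightarrow> real"
  assumes dist_val: "dist x y = val (x - y)"
    and val_diff_le_max: "val (x - y) \<le> max (val x) (val y)"
    and val_mult: "val (x * y) = val x * val y"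

lemma val_ge_0: "0 \<le> val x"
  using zero_le_dist[of x 0] by (simp add: dist_val)

lemma val_eq_0_iff: "val x = 0 \<longleftrightarrow> x = 0"
  using dist_eq_0_iff[of x 0] by (simp add: dist_val)

definition valuation_ring :: "'k :: complete_valuation_field set" where
  "valuation_ring = {c. val c \<le> 1}"

definition quotient_by_valuation_ring :: "'k itself \<Rightarrow> 'k :: complete_valuation_field set set" where
  "quotient_by_valuation_ring _ = UNIV // {(x, y). x - y \<in> valuation_ring}"

definition lambda_field :: "'k :: complete_valuation_field itself \<Rightarrow> ('k set + nat) set rel" where
  "lambda_field K = cardSuc (card_max |quotient_by_valuation_ring K| natLeq)"

lemma lambda_field_uncountable:
  "Card_order (lambda_field K)" "natLeq <o lambda_field K"
proof -
  let ?q = "|quotient_by_valuation_ring K|"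
  have m: "Card_order (card_max ?q natLeq)"
    by (rule Card_order_card_max)
  then show "Card_order (lambda_field K)"
    by (simp add: lambda_field_def cardSuc_Card_order)
  have q: "Card_order ?q"
    by (rule card_of_Card_order)
  have "natLeq \<le>o card_max ?q natLeq"
  proof (cases "?q \<le>o natLeq")
    case True
    from card_max_absorb2[OF q natLeq_Card_order True] show ?thesis
      by (simp add: ordIso_iff_ordLeq)
  next
    case False
    then have *: "natLeq \<le>o ?q"
      using ordLeq_total[OF card_of_Well_order natLeq_Well_order] by blast
    then show ?thesis
      using card_max_absorb1[OF q natLeq_Card_order *]
      by (meson ordIso_iff_ordLeq ordLeq_transitive)
  qed
  then show "natLeq <o lambda_field K"
    unfolding lambda_field_def using cardSuc_greater[OF m] ordLeq_ordLess_trans by blast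
qed

definition C0 :: "'a set \<Rightarrow> ('a \<Rightarrow> 'k :: complete_valuation_field) set" where
  "C0 E = {c. \<forall>\<epsilon>>0. finite {e \<in> E. val (c e) \<ge> \<epsilon>}}"

definition C0_norm :: "'a set \<Rightarrow> ('a \<Rightarrow> 'k :: complete_valuation_field) \<Rightarrow> real" where
  "C0_norm E c = (if E = {} then 0 else (SUP e\<in>E. val (c e)))"

locale banach_vector_space = vector_space scale
  for scale :: "'k :: complete_valuation_field \<Rightarrow> 'v \<Rightarrow> 'v :: {ab_group_add, complete_space}"
    (infixr \<open>*s\<close> 75) +
  fixes nrm :: "'v \<Rightarrow> real" (\<open>\<parallel>_\<parallel>\<close>)
  assumes dist_nrm: "dist u v = \<parallel>u - v\<parallel>"
    and nrm_diff_le_max: "\<parallel>u - v\<parallel> \<le> max \<parallel>u\<parallel> \<parallel>v\<parallel>"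
    and nrm_scale: "\<parallel>c *s v\<parallel> = val c * \<parallel>v\<parallel>"
begin

lemma nrm_ge_0: "0 \<le> \<parallel>v\<parallel>"
  using zero_le_dist[of v 0] by (simp add: dist_nrm)

lemma nrm_eq_0_iff: "\<parallel>v\<parallel> = 0 \<longleftrightarrow> v = 0"
  using dist_eq_0_iff[of v 0] by (simp add: dist_nrm)

definition closed_span :: "'v set \<Rightarrow> 'v set" where
  "closed_span S = closure (span S)"

definition rank :: "'v rel" where
  "rank = (SOME r. (\<exists>S. closed_span S = UNIV \<and> r = |S| ) \<and>
                   (\<forall>S. closed_span S = UNIV \<longrightarrow> r \<le>o |S| ))"

lemma rank_minimal:
  shows rank_attained: "\<exists>S. closed_span S = UNIV \<and> rank = |S|"
    and rank_le: "closed_span S = UNIV \<Longrightarrow> rank \<le>o |S|"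
    and Card_order_rank: "Card_order rank"
proof -
  let ?R = "card_of ` {S. closed_span S = UNIV}"
  have "closed_span UNIV = UNIV"
    by (simp add: closed_span_def span_UNIV)
  then have "?R \<noteq> {}"
    by blast
  then have "\<exists>r\<in>?R. \<forall>r'\<in>?R. r \<le>o r'"
    using exists_minim_Card_order[of ?R] card_of_Card_order by blast
  then have "\<exists>r. (\<exists>S. closed_span S = UNIV \<and> r = |S| ) \<and>
                 (\<forall>S. closed_span S = UNIV \<longrightarrow> r \<le>o |S| )"
    by auto
  from someI_ex[OF this, folded rank_def]
  show "\<exists>S. closed_span S = UNIV \<and> rank = |S|"
    and "closed_span S = UNIV \<Longrightarrow> rank \<le>o |S|" and "Card_order rank"
    by (auto simp: card_of_Card_order)
qed

text \<open>
  Here \<open>W\<close> is a closed subspace. The coefficients outside \<open>E\<close> are irrelevant to \<^const>\<open>C0\<close>,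
  \<^const>\<open>C0_norm\<close> and the sums over \<open>E\<close>, so that \<open>C0 E\<close> stands for the space of maps defined on \<open>E\<close>
  only.
\<close>

definition orthonormal_schauder_basis :: "'v set \<Rightarrow> 'v set \<Rightarrow> bool" where
  "orthonormal_schauder_basis W E \<longleftrightarrow>
     E \<subseteq> W \<and>
     (\<forall>e\<in>E. \<parallel>e\<parallel> = 1) \<and>
     (\<forall>c\<in>C0 E. (\<lambda>e. c e *s e) summable_on E \<and> \<parallel>\<Sum>\<^sub>\<infinity>e\<in>E. c e *s e\<parallel> = C0_norm E c) \<and>
     (\<forall>v\<in>W. \<exists>c\<in>C0 E. ((\<lambda>e. c e *s e) has_sum v) E)"

definition free_subspace :: "'v set \<Rightarrow> bool" where
  "free_subspace W \<longleftrightarrow> (\<exists>E. orthonormal_schauder_basis W E)"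

definition free :: bool where
  "free \<longleftrightarrow> free_subspace UNIV"

definition cardinal_free :: "'b rel \<Rightarrow> bool" where
  "cardinal_free \<kappa> \<longleftrightarrow> (\<forall>S. |S| <o \<kappa> \<longrightarrow> free_subspace (closed_span S))"

definition almost_free :: bool where
  "almost_free \<longleftrightarrow> cardinal_free rank"

end

end

theory Submission
  imports Defs
begin

text \<open>
  Say that \<open>V\<close> has coordinates when it embeds isometrically into some \<open>C\<^sub>0(I, k)\<close>. By Gruson's
  theorem every closed subspace of such a space is free: maximal partial bases exist by Zorn's lemma,
  and a partial basis is enlarged by countably many vectors at a time, which are then orthonormalized
  by Gaussian elimination. This gives (1) implies (2).

  Conversely let \<open>\<kappa>\<close> be the rank. If \<open>\<kappa>\<close> is regular, then \<open>V\<close> is the union of a chain of \<open>\<kappa>\<close> free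
  subspaces, and the tails of \<open>\<kappa>\<close> generate a \<open>\<kappa>\<close>-complete filter. Along a \<open>\<lambda>\<^sub>k\<close>-complete ultrafilter
  extending it every function with values in \<open>k\<close> is almost constant, so that the coordinates
  on the subspaces converge to coordinates on \<open>V\<close>. (This needs a nontrivial valuation; for a trivial
  one, any algebraic basis is an orthonormal Schauder basis.)

  If \<open>\<kappa>\<close> is singular, then every \<open>\<kappa>\<close>-complete filter on \<open>\<kappa>\<close> is principal and strong compactness is
  void. In this case Shelah's singular compactness argument applies, where Gruson's theorem plays the
  role that the freeness of subgroups of free groups plays for abelian groups.
\<close>

text \<open>In general a closed subspace has no orthogonal complement, and over a densely valued
  field distances to it need not be attained, so a basis cannot be built by picking nearest vectors
  one at a time. Coordinates that tend to zero are the remedy: every vector then has a largest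
  coordinate, at which one can pivot. Freeness is therefore handled through two notions about finite
  sums, \<open>ortho_mod\<close> (orthonormality modulo a subspace) and \<open>coords\<close>
  (coordinates on a quotient); infinite sums occur only in the translation
  \<open>free_subspace_iff\<close>.

  For a trivial valuation \<open>O_k = k\<close>, so \<open>k/O_k\<close> is a single point and says
  nothing about functions into \<open>k\<close>.

  The bases of the members of a chain need not be compatible. For regular rank they never have to be
  matched, because only limits of functionals are taken. For singular rank they must be matched,
  which is why extendability of bases is made a property of spaces (\<open>basis_extends\<close>,
  \<open>pure_in\<close>) before any basis is chosen.\<close>

no_notation vector_scalar_mult (infixl \<open>*s\<close> 70)

section \<open>Norms and orthonormal sets\<close>

declare val_ge_0 [simp]

lemma val_0 [simp]: "val 0 = 0"
  by (simp add: val_eq_0_iff)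

lemma val_1 [simp]: "val (1 :: 'k :: complete_valuation_field) = 1"
proof -
  have "val (1 :: 'k) * val (1 :: 'k) = val (1 :: 'k)"
    unfolding val_mult[symmetric] by simp
  then show ?thesis
    using val_eq_0_iff[of "1 :: 'k"] by simp
qed

lemma val_minus [simp]: "val (- x) = val x"
proof -
  have "val (- y) \<le> val y" for y :: 'a
    using val_diff_le_max[of 0 y] val_ge_0[of y] by simp
  from this[of x] this[of "- x"] show ?thesis by simp
qed

lemma val_add_le_max: "val (x + y) \<le> max (val x) (val y)"
  using val_diff_le_max[of x "- y"] by simp

lemma val_inverse: "val (inverse x) = inverse (val x)"
proof (cases "x = 0")
  case False
  then have "val x * val (inverse x) = 1"
    by (simp flip: val_mult)
  then show ?thesis
    by (metis inverse_unique)
qed simp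

lemma val_divide: "val (x / y) = val x / val y"
  by (simp add: divide_inverse val_mult val_inverse)

lemma val_power: "val (x ^ n) = val x ^ n"
  by (induction n) (simp_all add: val_mult)

text \<open>A maximum of \<open>A\<close>, if there is one, together with one element above each
  rational that has one suffices: between a non-maximal element and a larger one lies a rational.
  This is the source of countable generation in \<open>coords_countable_generators\<close>.\<close>

lemma countable_cofinal_reals:
  fixes A :: "real set"
  obtains C where "C \<subseteq> A" "countable C" "\<And>a. a \<in> A \<Longrightarrow> \<exists>c\<in>C. a \<le> c"
proof -
  define C where "C = {a \<in> A. \<forall>b\<in>A. b \<le> a} \<union> (\<lambda>q. SOME a. a \<in> A \<and> q \<le> a) ` {q \<in> \<rat>. \<exists>a\<in>A. q \<le> a}"
  have some: "(SOME a. a \<in> A \<and> q \<le> a) \<in> A \<and> q \<le> (SOME a. a \<in> A \<and> q \<le> a)" if "\<exists>a\<in>A. q \<le> a" for q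
    using that by (rule bexE) (rule someI, erule (1) conjI)
  have "{a \<in> A. \<forall>b\<in>A. b \<le> a} \<subseteq> {Sup A}"
    using cSup_eq_maximum[of _ A] by (metis (no_types, lifting) mem_Collect_eq singletonI subsetI)
  then have "countable {a \<in> A. \<forall>b\<in>A. b \<le> a}"
    by (rule countable_subset) simp
  then have "countable C"
    unfolding C_def using countable_subset[OF _ countable_rat, of "{q \<in> \<rat>. \<exists>a\<in>A. q \<le> a}"] by simp
  moreover have "C \<subseteq> A"
    unfolding C_def using some by auto
  moreover have "\<exists>c\<in>C. a \<le> c" if a: "a \<in> A" for a
  proof (cases "\<forall>b\<in>A. b \<le> a")
    case True
    then show ?thesis using a unfolding C_def by auto
  next
    case False
    then obtain b where b: "b \<in> A" "a < b" by auto
    then obtain q where q: "q \<in> \<rat>" "a < q" "q < b"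
      using Rats_dense_in_real by blast
    define c where "c = (SOME a. a \<in> A \<and> q \<le> a)"
    have "\<exists>a\<in>A. q \<le> a" using b(1) q(3) less_imp_le by blast
    with q have "c \<in> C" "q \<le> c"
      unfolding C_def c_def using some[of q] by blast+
    then show ?thesis using q(2) less_imp_le[OF less_le_trans] by blast
  qed
  ultimately show ?thesis using that by blast
qed

context banach_vector_space
begin

lemma nrm_0 [simp]: "\<parallel>0\<parallel> = 0"
  by (simp add: nrm_eq_0_iff)

lemma nrm_minus [simp]: "\<parallel>- u\<parallel> = \<parallel>u\<parallel>"
proof -
  have "\<parallel>- v\<parallel> \<le> \<parallel>v\<parallel>" for v
    using nrm_diff_le_max[of 0 v] nrm_ge_0[of v] by simp
  from this[of u] this[of "- u"] show ?thesis by simp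
qed

lemma nrm_minus_commute: "\<parallel>u - v\<parallel> = \<parallel>v - u\<parallel>"
  using nrm_minus[of "u - v"] by simp

lemma nrm_add_le_max: "\<parallel>u + v\<parallel> \<le> max \<parallel>u\<parallel> \<parallel>v\<parallel>"
  using nrm_diff_le_max[of u "- v"] by simp

lemma nrm_add_le: "\<parallel>u\<parallel> \<le> r \<Longrightarrow> \<parallel>v\<parallel> \<le> r \<Longrightarrow> \<parallel>u + v\<parallel> \<le> r"
  using nrm_add_le_max[of u v] by simp

lemma nrm_diff_le: "\<parallel>u\<parallel> \<le> r \<Longrightarrow> \<parallel>v\<parallel> \<le> r \<Longrightarrow> \<parallel>u - v\<parallel> \<le> r"
  using nrm_diff_le_max[of u v] by simp

lemma nrm_diff_less: "\<parallel>u\<parallel> < r \<Longrightarrow> \<parallel>v\<parallel> < r \<Longrightarrow> \<parallel>u - v\<parallel> < r"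
  using nrm_diff_le_max[of u v] by simp

lemma nrm_sum_le: "0 \<le> r \<Longrightarrow> (\<And>e. e \<in> F \<Longrightarrow> \<parallel>f e\<parallel> \<le> r) \<Longrightarrow> \<parallel>sum f F\<parallel> \<le> r"
  by (induction F rule: infinite_finite_induct) (auto intro: nrm_add_le)

lemma nrm_sum_less: "0 < r \<Longrightarrow> (\<And>e. e \<in> F \<Longrightarrow> \<parallel>f e\<parallel> < r) \<Longrightarrow> \<parallel>sum f F\<parallel> < r"
proof (induction F rule: infinite_finite_induct)
  case (insert e F)
  then show ?case using nrm_add_le_max[of "f e" "sum f F"] by (fastforce simp: max_def split: if_splits)
qed auto

text \<open>Ultrametric triangles are isosceles, so approximation closer than the norm keeps the
  norm exactly.\<close>

lemma nrm_eq_if_close: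
  assumes "\<parallel>u - v\<parallel> < \<parallel>u\<parallel>"
  shows "\<parallel>v\<parallel> = \<parallel>u\<parallel>"
proof -
  have "\<parallel>v\<parallel> \<le> \<parallel>u\<parallel>"
    using nrm_diff_le_max[of u "u - v"] assms by simp
  moreover have "\<parallel>u\<parallel> \<le> max \<parallel>v\<parallel> \<parallel>u - v\<parallel>"
    using nrm_add_le_max[of v "u - v"] by simp
  ultimately show ?thesis using assms by linarith
qed

section \<open>Closures and closed spans\<close>

lemma in_closure_iff: "v \<in> closure S \<longleftrightarrow> (\<forall>\<epsilon>>0. \<exists>s\<in>S. \<parallel>v - s\<parallel> < \<epsilon>)"
  unfolding closure_approachable dist_nrm by (metis nrm_minus_commute)

lemma in_closed_span_iff: "v \<in> closed_span S \<longleftrightarrow> (\<forall>\<epsilon>>0. \<exists>s\<in>span S. \<parallel>v - s\<parallel> < \<epsilon>)"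
  by (simp add: closed_span_def in_closure_iff)

lemma closed_spanE:
  assumes "v \<in> closed_span S" "0 < \<epsilon>"
  obtains s where "s \<in> span S" "\<parallel>v - s\<parallel> < \<epsilon>"
  using assms unfolding in_closed_span_iff by blast

lemma closed_closed_span [simp]: "closed (closed_span S)"
  by (simp add: closed_span_def)

lemma span_subset_closed_span: "span S \<subseteq> closed_span S"
  by (simp add: closed_span_def closure_subset)

lemma closed_span_superset: "S \<subseteq> closed_span S"
  using span_subset_closed_span span_superset by blast

lemma subspace_closure:
  assumes "subspace S"
  shows "subspace (closure S)"
proof (rule subspaceI)
  show "0 \<in> closure S"
    using subspace_0[OF assms] closure_subset by blast
next
  fix u v assume uv: "u \<in> closure S" "v \<in> closure S"
  show "u + v \<in> closure S"
    unfolding in_closure_iff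
  proof (intro allI impI)
    fix \<epsilon> :: real assume "0 < \<epsilon>"
    then obtain s t where st: "s \<in> S" "\<parallel>u - s\<parallel> < \<epsilon>" "t \<in> S" "\<parallel>v - t\<parallel> < \<epsilon>"
      using uv unfolding in_closure_iff by meson
    have "\<parallel>u + v - (s + t)\<parallel> = \<parallel>(u - s) + (v - t)\<parallel>"
      by (simp add: algebra_simps)
    also have "\<dots> < \<epsilon>"
      using nrm_add_le_max[of "u - s" "v - t"] st by linarith
    finally show "\<exists>r\<in>S. \<parallel>u + v - r\<parallel> < \<epsilon>"
      using subspace_add[OF assms st(1,3)] by blast
  qed
next
  fix c u assume u: "u \<in> closure S"
  show "c *s u \<in> closure S"
    unfolding in_closure_iff
  proof (intro allI impI)
    fix \<epsilon> :: real assume \<epsilon>: "0 < \<epsilon>"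
    \<comment> \<open>The added 1 keeps the tolerance meaningful for \<open>c = 0\<close>.\<close>
    have pos: "0 < val c + 1"
      using val_ge_0[of c] by linarith
    obtain s where s: "s \<in> S" "\<parallel>u - s\<parallel> < \<epsilon> / (val c + 1)"
      using u \<epsilon> pos unfolding in_closure_iff by (meson divide_pos_pos)
    have "\<parallel>c *s u - c *s s\<parallel> = val c * \<parallel>u - s\<parallel>"
      by (simp flip: scale_right_diff_distrib add: nrm_scale)
    also have "\<dots> \<le> (val c + 1) * \<parallel>u - s\<parallel>"
      using nrm_ge_0[of "u - s"] by (simp add: algebra_simps)
    also have "\<dots> < \<epsilon>"
      using s pos by (simp add: field_simps)
    finally show "\<exists>r\<in>S. \<parallel>c *s u - r\<parallel> < \<epsilon>"
      using subspace_scale[OF assms s(1)] by blast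
  qed
qed

lemma subspace_closed_span [simp]: "subspace (closed_span S)"
  by (simp add: closed_span_def subspace_closure)

lemma closed_span_minimal: "S \<subseteq> W \<Longrightarrow> subspace W \<Longrightarrow> closed W \<Longrightarrow> closed_span S \<subseteq> W"
  unfolding closed_span_def by (simp add: closure_minimal span_minimal)

lemma closed_span_subsetI: "S \<subseteq> closed_span T \<Longrightarrow> closed_span S \<subseteq> closed_span T"
  by (simp add: closed_span_minimal)

lemma closed_span_mono: "S \<subseteq> T \<Longrightarrow> closed_span S \<subseteq> closed_span T"
  by (meson closed_span_subsetI closed_span_superset subset_trans)

lemma in_closed_spanI_limit:
  assumes "\<And>n. \<exists>m\<in>closed_span S. \<parallel>v - m\<parallel> \<le> 1 / real (Suc n)"
  shows "v \<in> closed_span S"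
proof -
  have "v \<in> closure (closed_span S)"
    unfolding in_closure_iff
  proof (intro allI impI)
    fix \<epsilon> :: real assume "0 < \<epsilon>"
    then obtain n where "1 / real (Suc n) < \<epsilon>"
      using nat_approx_posE by blast
    then show "\<exists>s\<in>closed_span S. \<parallel>v - s\<parallel> < \<epsilon>"
      using assms[of n] by force
  qed
  then show ?thesis by simp
qed

text \<open>A limit of a sequence of finite combinations involves only countably many generators.
  The cardinality bounds of the singular case rest on this, since countable sets are absorbed by
  infinite cardinals.\<close>

lemma closed_span_countable_subset:
  assumes "v \<in> closed_span S"
  obtains C where "C \<subseteq> S" "countable C" "v \<in> closed_span C"
proof -
  have "\<exists>F. finite F \<and> F \<subseteq> S \<and> (\<exists>s\<in>span F. \<parallel>v - s\<parallel> < 1 / real (Suc n))" for n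
  proof -
    obtain s where s: "s \<in> span S" "\<parallel>v - s\<parallel> < 1 / real (Suc n)"
      using closed_spanE[OF assms, of "1 / real (Suc n)"] by auto
    from s(1) obtain F r where "finite F" "F \<subseteq> S" "s = (\<Sum>a\<in>F. r a *s a)"
      unfolding span_explicit by blast
    then show ?thesis
      using s(2) span_sum[of F "\<lambda>a. r a *s a" F] span_scale span_base by metis
  qed
  then obtain F where F: "\<And>n. finite (F n)" "\<And>n. F n \<subseteq> S" "\<And>n. \<exists>s\<in>span (F n). \<parallel>v - s\<parallel> < 1 / real (Suc n)"
    by metis
  have "v \<in> closed_span (\<Union>n. F n)"
  proof (rule in_closed_spanI_limit)
    fix n
    obtain s where "s \<in> span (F n)" "\<parallel>v - s\<parallel> < 1 / real (Suc n)"
      using F(3) by blast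
    moreover have "span (F n) \<subseteq> closed_span (\<Union>n. F n)"
      using span_mono[of "F n" "\<Union>n. F n"] span_subset_closed_span by blast
    ultimately show "\<exists>m\<in>closed_span (\<Union>n. F n). \<parallel>v - m\<parallel> \<le> 1 / real (Suc n)"
      by force
  qed
  then show ?thesis
    using that[of "\<Union>n. F n"] F by (simp add: UN_least countable_finite)
qed

text \<open>For a subspace \<open>M\<close>: unit vectors whose images in the quotient by
  \<open>M\<close> are orthonormal. Only the lower bound on norms is demanded; the upper bound
  follows from the unit norms and the ultrametric inequality.\<close>

definition ortho_mod :: "'v set \<Rightarrow> 'v set \<Rightarrow> bool" where
  "ortho_mod M C \<longleftrightarrow> (\<forall>e\<in>C. \<parallel>e\<parallel> = 1) \<and>
     (\<forall>F c w e. finite F \<and> F \<subseteq> C \<and> w \<in> M \<and> e \<in> F \<longrightarrow> val (c e) \<le> \<parallel>(\<Sum>a\<in>F. c a *s a) + w\<parallel>)"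

abbreviation orthonormal :: "'v set \<Rightarrow> bool" where
  "orthonormal \<equiv> ortho_mod {0}"

definition onb :: "'v set \<Rightarrow> 'v set \<Rightarrow> bool" where
  "onb W B \<longleftrightarrow> orthonormal B \<and> closed_span B = W"

lemma ortho_modD1: "ortho_mod M C \<Longrightarrow> e \<in> C \<Longrightarrow> \<parallel>e\<parallel> = 1"
  by (simp add: ortho_mod_def)

lemma ortho_modD2:
  "ortho_mod M C \<Longrightarrow> finite F \<Longrightarrow> F \<subseteq> C \<Longrightarrow> w \<in> M \<Longrightarrow> e \<in> F \<Longrightarrow> val (c e) \<le> \<parallel>(\<Sum>a\<in>F. c a *s a) + w\<parallel>"
  unfolding ortho_mod_def by blast

lemma orthonormalD: "orthonormal C \<Longrightarrow> finite F \<Longrightarrow> F \<subseteq> C \<Longrightarrow> e \<in> F \<Longrightarrow> val (c e) \<le> \<parallel>\<Sum>a\<in>F. c a *s a\<parallel>"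
  using ortho_modD2[of "{0}" C F 0] by simp

lemma ortho_mod_mono: "ortho_mod M C \<Longrightarrow> C' \<subseteq> C \<Longrightarrow> M' \<subseteq> M \<Longrightarrow> ortho_mod M' C'"
  unfolding ortho_mod_def by blast

lemma ortho_mod_nrm_ge:
  assumes C: "ortho_mod M C" and F: "finite F" "F \<subseteq> C" and w: "w \<in> M"
  shows "\<parallel>w\<parallel> \<le> \<parallel>(\<Sum>a\<in>F. c a *s a) + w\<parallel>" (is "_ \<le> \<parallel>?s + w\<parallel>")
proof -
  have "\<parallel>?s\<parallel> \<le> \<parallel>?s + w\<parallel>"
    using ortho_modD2[OF C F w] F ortho_modD1[OF C]
    by (intro nrm_sum_le) (auto simp: nrm_scale nrm_ge_0 subset_iff)
  then show ?thesis
    using nrm_diff_le[of "?s + w" "\<parallel>?s + w\<parallel>" ?s] by simp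
qed

text \<open>For \<open>w\<close> in \<open>span C\<close> the whole sum is a finite combination of
  \<open>B\<close>; limits are treated afterwards by approximation.\<close>

lemma ortho_mod_closed_spanI:
  assumes B: "orthonormal B" and C: "C \<subseteq> B"
  shows "ortho_mod (closed_span C) (B - C)"
  unfolding ortho_mod_def
proof (intro conjI allI impI ballI)
  show "\<parallel>e\<parallel> = 1" if "e \<in> B - C" for e
    using that ortho_modD1[OF B] by blast
next
  fix F and c :: "'v \<Rightarrow> 'k" and w e :: 'v
  assume "finite F \<and> F \<subseteq> B - C \<and> w \<in> closed_span C \<and> e \<in> F"
  then have F: "finite F" "F \<subseteq> B - C" and w: "w \<in> closed_span C" and e: "e \<in> F"
    by auto
  have key: "val (c e) \<le> \<parallel>(\<Sum>a\<in>F. c a *s a) + s\<parallel>" if s: "s \<in> span C" for s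
  proof -
    obtain G r where G: "finite G" "G \<subseteq> C" and s: "s = (\<Sum>a\<in>G. r a *s a)"
      using s unfolding span_explicit by blast
    define d where "d a = (if a \<in> F then c a else r a)" for a
    have disj: "F \<inter> G = {}"
      using F G by blast
    have "(\<Sum>a\<in>F \<union> G. d a *s a) = (\<Sum>a\<in>F. d a *s a) + (\<Sum>a\<in>G. d a *s a)"
      using F G disj by (simp add: sum.union_disjoint)
    also have "(\<Sum>a\<in>F. d a *s a) = (\<Sum>a\<in>F. c a *s a)"
      by (simp add: d_def)
    also have "(\<Sum>a\<in>G. d a *s a) = s"
      unfolding s using disj by (intro sum.cong) (auto simp: d_def)
    finally show ?thesis
      using orthonormalD[OF B, of "F \<union> G" e d] F G C e by (auto simp: d_def)
  qed
  show "val (c e) \<le> \<parallel>(\<Sum>a\<in>F. c a *s a) + w\<parallel>" (is "_ \<le> \<parallel>?s + w\<parallel>")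
  \<comment> \<open>If the bound failed, some \<open>t\<close> in \<open>span C\<close> nearer to
    \<open>w\<close> than \<open>val (c e)\<close> would violate \<open>key\<close>.\<close>
  proof (rule ccontr)
    assume less: "\<not> ?thesis"
    then have "0 < val (c e)"
      using nrm_ge_0[of "?s + w"] by linarith
    then obtain t where t: "t \<in> span C" "\<parallel>w - t\<parallel> < val (c e)"
      using closed_spanE[OF w] by blast
    have "\<parallel>(?s + w) - (w - t)\<parallel> < val (c e)"
      using less t(2) by (intro nrm_diff_less[of "?s + w"]) auto
    then show False
      using key[OF t(1)] by (simp add: algebra_simps)
  qed
qed

text \<open>The part of a sum inside \<open>B\<close> lies in \<open>closed_span B\<close>. Modulo
  it the coefficients at \<open>C\<close> are bounded, and by \<open>ortho_mod_nrm_ge\<close> the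
  part itself is no longer than the whole sum.\<close>

lemma orthonormal_Un:
  assumes B: "orthonormal B" and C: "ortho_mod (closed_span B) C"
  shows "orthonormal (B \<union> C)"
  unfolding ortho_mod_def
proof (intro conjI allI impI ballI)
  show "\<parallel>e\<parallel> = 1" if "e \<in> B \<union> C" for e
    using that ortho_modD1[OF B] ortho_modD1[OF C] by blast
next
  fix F and c :: "'v \<Rightarrow> 'k" and w e :: 'v
  assume "finite F \<and> F \<subseteq> B \<union> C \<and> w \<in> {0} \<and> e \<in> F"
  then have F: "finite F" "F \<subseteq> B \<union> C" and w: "w = 0" and e: "e \<in> F"
    by auto
  let ?b = "\<Sum>a\<in>F \<inter> B. c a *s a" and ?c = "\<Sum>a\<in>F - B. c a *s a"
  have b: "?b \<in> closed_span B"
    using span_subset_closed_span by (intro subsetD[OF span_subset_closed_span] span_sum span_scale span_base) auto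
  have sum: "(\<Sum>a\<in>F. c a *s a) = ?c + ?b"
    using sum.Int_Diff[OF F(1), of "\<lambda>a. c a *s a" B] by (simp add: add.commute)
  have FC: "finite (F - B)" "F - B \<subseteq> C" using F by auto
  show "val (c e) \<le> \<parallel>(\<Sum>a\<in>F. c a *s a) + w\<parallel>"
  proof (cases "e \<in> B")
    case True
    then have "val (c e) \<le> \<parallel>?b\<parallel>"
      using e F by (intro orthonormalD[OF B]) auto
    then show ?thesis
      using ortho_mod_nrm_ge[OF C FC b, of c] by (simp add: sum w)
  next
    case False
    then show ?thesis
      using ortho_modD2[OF C FC b, of e c] e by (simp add: sum w)
  qed
qed

text \<open>With coefficient 1 at \<open>e\<close> and \<open>- e\<close> as the vector of
  \<open>closed_span C\<close>, orthonormality modulo that space would give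
  \<open>1 \<le> 0\<close>. So an orthonormal set has no redundant member.\<close>

lemma orthonormal_notin_closed_span:
  assumes "orthonormal B" "C \<subseteq> B" "e \<in> B" "e \<in> closed_span C"
  shows "e \<in> C"
proof (rule ccontr)
  assume "e \<notin> C"
  then have "val (1 :: 'k) \<le> \<parallel>(\<Sum>a\<in>{e}. 1 *s a) + (- e)\<parallel>"
    using assms subspace_neg[OF subspace_closed_span]
    by (intro ortho_modD2[OF ortho_mod_closed_spanI[OF assms(1,2)]]) auto
  then show False by simp
qed

lemma orthonormal_Union_chain:
  assumes ne: "\<C> \<noteq> {}" and chain: "subset.chain UNIV \<C>" and "\<And>B. B \<in> \<C> \<Longrightarrow> orthonormal B"
  shows "orthonormal (\<Union>\<C>)"
  unfolding ortho_mod_def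
proof (intro conjI allI impI ballI)
  show "\<parallel>e\<parallel> = 1" if "e \<in> \<Union>\<C>" for e
    using that assms(3) ortho_modD1 by blast
next
  fix F and c :: "'v \<Rightarrow> 'k" and w e :: 'v
  assume *: "finite F \<and> F \<subseteq> \<Union>\<C> \<and> w \<in> {0} \<and> e \<in> F"
  then obtain B where "B \<in> \<C>" "F \<subseteq> B"
    using finite_subset_Union_chain[OF _ _ ne chain] by blast
  then show "val (c e) \<le> \<parallel>(\<Sum>a\<in>F. c a *s a) + w\<parallel>"
    using * assms(3) ortho_modD2[of "{0}" B F w e c] by blast
qed

lemma orthonormal_empty [simp]: "orthonormal {}"
  by (simp add: ortho_mod_def)

end

section \<open>Coordinates and Gruson's theorem\<close>

context banach_vector_space
begin

text \<open>
  Essentially an isometric embedding of the quotient of \<open>W\<close> by \<open>closed_span B\<close> into \<open>C0 I\<close>. The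
  quotient norm is only tested at the values \<open>1 / Suc n\<close> because the closing-off arguments below can
  treat countably many bounds at a time; \<open>n = 0\<close> yields representatives of norm exactly 1.
\<close>

definition coords :: "'v set \<Rightarrow> 'v set \<Rightarrow> 'i set \<Rightarrow> ('i \<Rightarrow> 'v \<Rightarrow> 'k) \<Rightarrow> bool" where
  "coords W B I x \<longleftrightarrow>
     (\<forall>i\<in>I. \<forall>u\<in>W. \<forall>v\<in>W. x i (u + v) = x i u + x i v) \<and>
     (\<forall>i\<in>I. \<forall>u\<in>W. \<forall>c. x i (c *s u) = c * x i u) \<and>
     (\<forall>i\<in>I. \<forall>u\<in>W. val (x i u) \<le> \<parallel>u\<parallel>) \<and>
     (\<forall>u\<in>W. \<forall>\<epsilon>>0. finite {i \<in> I. \<epsilon> \<le> val (x i u)}) \<and>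
     (\<forall>i\<in>I. \<forall>b\<in>B. x i b = 0) \<and>
     (\<forall>u\<in>W. \<forall>n. (\<forall>i\<in>I. val (x i u) \<le> 1 / real (Suc n)) \<longrightarrow>
        (\<exists>m\<in>closed_span B. \<parallel>u - m\<parallel> \<le> 1 / real (Suc n)))"

lemma coordsD:
  assumes "coords W B I x"
  shows coords_add: "i \<in> I \<Longrightarrow> u \<in> W \<Longrightarrow> v \<in> W \<Longrightarrow> x i (u + v) = x i u + x i v"
    and coords_scale: "i \<in> I \<Longrightarrow> u \<in> W \<Longrightarrow> x i (c *s u) = c * x i u"
    and coords_le: "i \<in> I \<Longrightarrow> u \<in> W \<Longrightarrow> val (x i u) \<le> \<parallel>u\<parallel>"
    and coords_finite: "u \<in> W \<Longrightarrow> 0 < \<epsilon> \<Longrightarrow> finite {i \<in> I. \<epsilon> \<le> val (x i u)}"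
    and coords_zero: "i \<in> I \<Longrightarrow> b \<in> B \<Longrightarrow> x i b = 0"
    and coords_approx: "u \<in> W \<Longrightarrow> (\<And>i. i \<in> I \<Longrightarrow> val (x i u) \<le> 1 / real (Suc n)) \<Longrightarrow>
          \<exists>m\<in>closed_span B. \<parallel>u - m\<parallel> \<le> 1 / real (Suc n)"
  using assms unfolding coords_def by simp_all

lemma coords_diff:
  assumes "coords W B I x" "subspace W" "i \<in> I" "u \<in> W" "v \<in> W"
  shows "x i (u - v) = x i u - x i v"
proof -
  have "x i (u + (- 1) *s v) = x i u + (- 1) * x i v"
    using assms coords_add[OF assms(1)] coords_scale[OF assms(1)] subspace_scale[OF assms(2)] by metis
  then show ?thesis by simp
qed

lemma coords_mono: "coords W B I x \<Longrightarrow> W' \<subseteq> W \<Longrightarrow> coords W' B I x"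
  unfolding coords_def by (meson subsetD)

lemma coords_change:
  assumes x: "coords W B I x" and J: "J \<subseteq> I" and zero: "\<And>i a. i \<in> J \<Longrightarrow> a \<in> A \<Longrightarrow> x i a = 0"
    and approx: "\<And>u n. u \<in> W \<Longrightarrow> \<forall>i\<in>J. val (x i u) \<le> 1 / real (Suc n) \<Longrightarrow>
        \<exists>m\<in>closed_span A. \<parallel>u - m\<parallel> \<le> 1 / real (Suc n)"
  shows "coords W A J x"
proof -
  have "finite {i \<in> J. \<epsilon> \<le> val (x i u)}" if "u \<in> W" "0 < \<epsilon>" for u \<epsilon>
    by (rule finite_subset[OF _ coords_finite[OF x that]]) (use J in auto)
  then show ?thesis
    using x J zero approx unfolding coords_def by (simp add: subset_iff del: of_nat_Suc)
qed

text \<open>A coordinate is bounded by the norm, so its zero set is a closed subspace.\<close>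

lemma coords_vanish_closed_span:
  assumes x: "coords W B I x" and W: "subspace W" "closed W" and i: "i \<in> I"
    and S: "S \<subseteq> W" "\<And>s. s \<in> S \<Longrightarrow> x i s = 0" and v: "v \<in> closed_span S"
  shows "x i v = 0"
proof -
  have sub: "closed_span S \<subseteq> W"
    by (rule closed_span_minimal[OF S(1) W])
  have "span S \<subseteq> {u \<in> W. x i u = 0}"
  proof (rule span_minimal)
    show "S \<subseteq> {u \<in> W. x i u = 0}" using S by blast
    have "x i 0 = 0"
      using coords_scale[OF x i subspace_0[OF W(1)], of 0] by simp
    then show "subspace {u \<in> W. x i u = 0}"
      using subspace_0[OF W(1)] subspace_add[OF W(1)] subspace_scale[OF W(1)]
      by (intro subspaceI) (auto simp: coords_add[OF x i] coords_scale[OF x i])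
  qed
  then have *: "s \<in> W" "x i s = 0" if "s \<in> span S" for s
    using that by auto
  show ?thesis
  proof (rule ccontr)
    assume "x i v \<noteq> 0"
    then have "0 < val (x i v)"
      using val_ge_0[of "x i v"] val_eq_0_iff[of "x i v"] by linarith
    then obtain s where s: "s \<in> span S" "\<parallel>v - s\<parallel> < val (x i v)"
      using closed_spanE[OF v] by blast
    then have "x i (v - s) = x i v"
      using coords_diff[OF x W(1) i] * sub v by auto
    then show False
      using coords_le[OF x i, of "v - s"] s * sub v subspace_diff[OF W(1)] by auto
  qed
qed

text \<open>
  Pivoting: the new basis vector \<open>e\<close> is a multiple of \<open>w\<close> modulo \<open>closed_span B\<close>, normalized at a
  coordinate \<open>j\<close> where \<open>w\<close> is largest, and the other coordinates are cleared along \<open>e\<close>.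
\<close>

lemma coords_insert:
  assumes W: "subspace W" "closed W" and B: "B \<subseteq> W" "orthonormal B"
    and x: "coords W B I x" and w: "w \<in> W"
  obtains B' y where "B \<subseteq> B'" "B' \<subseteq> W" "orthonormal B'" "coords W B' I y"
    "w \<in> closed_span B'" "B' \<subseteq> closed_span (insert w B)"
proof (cases "\<forall>i\<in>I. x i w = 0")
  case True
  then have "w \<in> closed_span B"
    using coords_approx[OF x w] by (intro in_closed_spanI_limit) simp
  moreover have "B \<subseteq> closed_span (insert w B)"
    using closed_span_superset by blast
  ultimately show ?thesis
    using that[of B x] B x by blast
next
  case False
  then obtain i0 where i0: "i0 \<in> I" "x i0 w \<noteq> 0" by blast
  \<comment> \<open>Coordinates tend to zero, so only finitely many reach the nonzero value at
    \<open>i0\<close>; hence a largest coordinate exists.\<close>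
  define J where "J = {i \<in> I. val (x i0 w) \<le> val (x i w)}"
  have "0 < val (x i0 w)"
    using i0 val_ge_0[of "x i0 w"] val_eq_0_iff[of "x i0 w"] by linarith
  then have J: "finite J" "i0 \<in> J"
    using coords_finite[OF x w] i0 by (auto simp: J_def)
  have "Max ((\<lambda>i. val (x i w)) ` J) \<in> (\<lambda>i. val (x i w)) ` J"
    using J by (intro Max_in) auto
  then obtain j where j: "j \<in> J" "val (x j w) = Max ((\<lambda>i. val (x i w)) ` J)"
    by auto
  then have jI: "j \<in> I" by (simp add: J_def)
  have jmax: "val (x i w) \<le> val (x j w)" if "i \<in> I" for i
  proof (cases "i \<in> J")
    case True
    then show ?thesis using J(1) j(2) by simp
  next
    case False
    then show ?thesis using that j(1) by (simp add: J_def)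
  qed
  have jpos: "0 < val (x j w)"
    using \<open>0 < val (x i0 w)\<close> jmax[OF i0(1)] by linarith
  then have jnz: "x j w \<noteq> 0" by auto
  define e0 where "e0 = inverse (x j w) *s w"
  have e0W: "e0 \<in> W"
    using w W by (simp add: e0_def subspace_scale)
  have xe0: "x i e0 = inverse (x j w) * x i w" if "i \<in> I" for i
    using coords_scale[OF x that w] by (simp add: e0_def)
  have "val (x i e0) \<le> 1" if "i \<in> I" for i
    using jmax[OF that] jpos by (simp only: xe0[OF that] val_mult val_inverse) (simp add: field_simps)
  then obtain m where m: "m \<in> closed_span B" "\<parallel>e0 - m\<parallel> \<le> 1"
    using coords_approx[OF x e0W, of 0] by auto
  define e where "e = e0 - m"
  have mW: "m \<in> W"
    using closed_span_minimal[OF B(1) W] m by blast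
  have eW: "e \<in> W"
    using e0W mW W by (simp add: e_def subspace_diff)
  have xe: "x i e = x i e0" if "i \<in> I" for i
    using coords_diff[OF x W(1) that e0W mW]
      coords_vanish_closed_span[OF x W that B(1) coords_zero[OF x that] m(1)] by (simp add: e_def)
  have xje: "x j e = 1"
    using xe[OF jI] xe0[OF jI] jnz by simp
  have nrm_e: "\<parallel>e\<parallel> = 1"
    using coords_le[OF x jI eW] m xje by (simp add: e_def)
  have B': "orthonormal (B \<union> {e})"
  proof (rule orthonormal_Un[OF B(2)], unfold ortho_mod_def, intro conjI allI impI ballI)
    show "\<parallel>a\<parallel> = 1" if "a \<in> {e}" for a using that nrm_e by simp
    fix F and c :: "'v \<Rightarrow> 'k" and u a
    assume *: "finite F \<and> F \<subseteq> {e} \<and> u \<in> closed_span B \<and> a \<in> F"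
    then have F: "F = {e}" "a = e" and u: "u \<in> closed_span B" by auto
    have uW: "u \<in> W"
      using closed_span_minimal[OF B(1) W] u by blast
    \<comment> \<open>Coordinate \<open>j\<close> is 1 at \<open>e\<close> and vanishes on
      \<open>closed_span B\<close>, so it reads off the coefficient.\<close>
    have "x j (c e *s e + u) = c e"
      using coords_add[OF x jI _ uW, of "c e *s e"] coords_scale[OF x jI eW] xje
        coords_vanish_closed_span[OF x W jI B(1) coords_zero[OF x jI] u] subspace_scale[OF W(1) eW] by simp
    then have "val (c e) \<le> \<parallel>c e *s e + u\<parallel>"
      using coords_le[OF x jI, of "c e *s e + u"] subspace_add[OF W(1) subspace_scale[OF W(1) eW] uW] by simp
    then show "val (c a) \<le> \<parallel>(\<Sum>a\<in>F. c a *s a) + u\<parallel>"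
      by (simp add: F)
  qed
  define y where "y i d = x i d - x j d * x i e" for i d
  have val_xe: "val (x i e) \<le> 1" if "i \<in> I" for i
    using coords_le[OF x that eW] nrm_e by simp
  have val_y: "val (y i d) \<le> max (val (x i d)) (val (x j d))" if "i \<in> I" for i d
  proof -
    have "val (x j d * x i e) \<le> val (x j d)"
      using val_xe[OF that] by (simp add: val_mult mult_left_le)
    then show ?thesis
      using val_diff_le_max[of "x i d" "x j d * x i e"] unfolding y_def by linarith
  qed
  have coords_y: "coords W (B \<union> {e}) I y"
    unfolding coords_def
  proof (intro conjI ballI allI impI)
    fix i u v assume "i \<in> I" "u \<in> W" "v \<in> W"
    then show "y i (u + v) = y i u + y i v"
      using coords_add[OF x] jI by (simp add: y_def algebra_simps)
  next
    fix i u c assume "i \<in> I" "u \<in> W"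
    then show "y i (c *s u) = c * y i u"
      using coords_scale[OF x] jI by (simp add: y_def algebra_simps)
  next
    fix i u assume "i \<in> I" "u \<in> W"
    then show "val (y i u) \<le> \<parallel>u\<parallel>"
      using val_y[of i u] coords_le[OF x, of i u] coords_le[OF x jI, of u] by linarith
  next
    fix u and \<epsilon> :: real assume u: "u \<in> W" and \<epsilon>: "0 < \<epsilon>"
    \<comment> \<open>If a new coordinate has size \<open>\<epsilon>\<close>, then the old one or
      the correction \<open>x j u * x i e\<close> does; \<open>\<delta>\<close> bounds
      \<open>x i e\<close> from below in the second case.\<close>
    define \<delta> where "\<delta> = \<epsilon> / (val (x j u) + 1)"
    have pos: "0 < val (x j u) + 1"
      using val_ge_0[of "x j u"] by linarith
    have "{i \<in> I. \<epsilon> \<le> val (y i u)} \<subseteq> {i \<in> I. \<epsilon> \<le> val (x i u)} \<union> {i \<in> I. \<delta> \<le> val (x i e)}"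
    proof
      fix i assume "i \<in> {i \<in> I. \<epsilon> \<le> val (y i u)}"
      then have i: "i \<in> I" "\<epsilon> \<le> val (y i u)" by auto
      show "i \<in> {i \<in> I. \<epsilon> \<le> val (x i u)} \<union> {i \<in> I. \<delta> \<le> val (x i e)}"
      proof (cases "\<epsilon> \<le> val (x i u)")
        case False
        then have "\<epsilon> \<le> val (x j u) * val (x i e)"
          using i(2) val_diff_le_max[of "x i u" "x j u * x i e"] by (simp add: y_def val_mult)
        also have "\<dots> \<le> (val (x j u) + 1) * val (x i e)"
          using val_ge_0[of "x i e"] by (simp add: algebra_simps)
        finally have "\<delta> \<le> val (x i e)"
          using pos by (simp add: \<delta>_def field_simps)
        then show ?thesis using i by simp
      qed (use i in simp)
    qed
    moreover have "0 < \<delta>" using \<epsilon> pos by (simp add: \<delta>_def)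
    ultimately show "finite {i \<in> I. \<epsilon> \<le> val (y i u)}"
      using coords_finite[OF x u \<epsilon>] coords_finite[OF x eW] finite_subset by blast
  next
    fix i b assume "i \<in> I" "b \<in> B \<union> {e}"
    then show "y i b = 0"
      using coords_zero[OF x] jI xje by (auto simp: y_def)
  next
    fix u n assume u: "u \<in> W" and small: "\<forall>i\<in>I. val (y i u) \<le> 1 / real (Suc n)"
    \<comment> \<open>Removing the \<open>e\<close> component turns the new coordinates of
      \<open>u\<close> into old coordinates of \<open>d\<close>, to which the old approximation
      property applies.\<close>
    define d where "d = u - x j u *s e"
    have xW: "x j u *s e \<in> W" using W eW by (simp add: subspace_scale)
    have "d \<in> W" using u xW W by (simp add: d_def subspace_diff)
    moreover have "x i d = y i u" if "i \<in> I" for i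
      using coords_diff[OF x W(1) that u xW] coords_scale[OF x that eW] by (simp add: d_def y_def)
    ultimately obtain m where m: "m \<in> closed_span B" "\<parallel>d - m\<parallel> \<le> 1 / real (Suc n)"
      using coords_approx[OF x, of d n] small by metis
    have "x j u *s e + m \<in> closed_span (B \<union> {e})"
      using m(1) closed_span_mono[of B "B \<union> {e}"] closed_span_superset[of "B \<union> {e}"]
      by (intro subspace_add subspace_scale) auto
    moreover have "u - (x j u *s e + m) = d - m" by (simp add: d_def algebra_simps)
    ultimately show "\<exists>m\<in>closed_span (B \<union> {e}). \<parallel>u - m\<parallel> \<le> 1 / real (Suc n)"
      using m(2) by metis
  qed
  have "w = x j w *s (e + m)"
    using jnz by (simp add: e_def e0_def)
  moreover have "x j w *s (e + m) \<in> closed_span (B \<union> {e})"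
    using m(1) closed_span_mono[of B "B \<union> {e}"] closed_span_superset[of "B \<union> {e}"]
    by (intro subspace_add subspace_scale) auto
  ultimately have "w \<in> closed_span (B \<union> {e})" by simp
  moreover have "e \<in> closed_span (insert w B)"
    unfolding e_def e0_def using m(1) closed_span_mono[of B "insert w B"] closed_span_superset[of "insert w B"]
    by (intro subspace_diff subspace_scale) auto
  then have "B \<union> {e} \<subseteq> closed_span (insert w B)"
    using closed_span_superset[of "insert w B"] by auto
  ultimately show ?thesis
    using that[of "B \<union> {e}" y] B' B eW coords_y by blast
qed

text \<open>Each insertion changes the coordinate functions, so none are claimed for the union of
  the stages. In \<open>onb_extension\<close> the original \<open>x\<close> is used again, which
  works because \<open>B'\<close> stays inside \<open>closed_span (B \<union> T)\<close>.\<close>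

lemma coords_insert_countable:
  assumes W: "subspace W" "closed W" and B: "B \<subseteq> W" "orthonormal B"
    and x: "coords W B I x" and T: "T \<subseteq> W" "countable T"
  obtains B' where "B \<subseteq> B'" "B' \<subseteq> W" "orthonormal B'"
    "T \<subseteq> closed_span B'" "B' \<subseteq> closed_span (B \<union> T)"
proof (cases "T = {}")
  case True
  then show ?thesis using that[of B] B closed_span_superset[of B] by simp
next
  case False
  define t where "t = from_nat_into T"
  have t: "range t = T"
    using False T(2) by (simp add: t_def)
  define P where "P n A \<longleftrightarrow> B \<subseteq> A \<and> A \<subseteq> W \<and> orthonormal A \<and> A \<subseteq> closed_span (B \<union> T) \<and> (\<exists>y. coords W A I y)"
    for n :: nat and A
  define Q where "Q n A A' \<longleftrightarrow> A \<subseteq> A' \<and> t n \<in> closed_span A'" for n A A'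
  have "\<exists>f. \<forall>n. P n (f n) \<and> Q n (f n) (f (Suc n))"
  proof (rule dependent_nat_choice)
    show "\<exists>A. P 0 A"
      unfolding P_def using B x closed_span_superset[of "B \<union> T"] by (intro exI[of _ B]) auto
  next
    fix A n assume "P n A"
    then obtain y where A: "B \<subseteq> A" "A \<subseteq> W" "orthonormal A" "A \<subseteq> closed_span (B \<union> T)" "coords W A I y"
      unfolding P_def by blast
    have tn: "t n \<in> T" using t by blast
    obtain A' y' where A': "A \<subseteq> A'" "A' \<subseteq> W" "orthonormal A'" "coords W A' I y'"
      "t n \<in> closed_span A'" "A' \<subseteq> closed_span (insert (t n) A)"
      using coords_insert[OF W A(2,3,5), of "t n"] tn T(1) by blast
    have "insert (t n) A \<subseteq> closed_span (B \<union> T)"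
      using A(4) tn closed_span_superset[of "B \<union> T"] by blast
    then have "A' \<subseteq> closed_span (B \<union> T)"
      using A'(6) closed_span_subsetI by blast
    then show "\<exists>A'. P (Suc n) A' \<and> Q n A A'"
      using A A' unfolding P_def Q_def by blast
  qed
  then obtain f where f: "\<And>n. P n (f n)" "\<And>n. Q n (f n) (f (Suc n))" by blast
  have "mono f"
    using f(2) by (simp add: Q_def mono_iff_le_Suc)
  then have "f m \<subseteq> f n \<or> f n \<subseteq> f m" for m n
    using monoD le_cases by metis
  then have "subset.chain UNIV (range f)"
    unfolding subset_chain_def by auto
  then have "orthonormal (\<Union>(range f))"
    using f(1) by (intro orthonormal_Union_chain) (auto simp: P_def)
  moreover have "T \<subseteq> closed_span (\<Union>(range f))"
  proof
    fix s assume "s \<in> T"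
    then obtain n where "s = t n" using t by blast
    moreover have "closed_span (f (Suc n)) \<subseteq> closed_span (\<Union>(range f))"
      by (rule closed_span_mono) auto
    ultimately show "s \<in> closed_span (\<Union>(range f))"
      using f(2)[of n] by (auto simp: Q_def)
  qed
  moreover have "B \<subseteq> f 0"
    using f(1) by (simp add: P_def)
  then have "B \<subseteq> \<Union>(range f)" by blast
  moreover have "\<Union>(range f) \<subseteq> W" "\<Union>(range f) \<subseteq> closed_span (B \<union> T)"
    using f(1) by (auto simp: P_def)
  ultimately show ?thesis using that by blast
qed

text \<open>
  The vectors of \<open>W\<close> that are small at the coordinates outside \<open>F\<close> form a module over the
  valuation ring. As the value group has rank one, the projection of this module to a single
  coordinate is countably generated.
\<close>

lemma coords_countable_generators:
  assumes x: "coords W B I x" and W: "subspace W" and \<epsilon>: "0 \<le> \<epsilon>" and "finite F" "F \<subseteq> I"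
  shows "\<exists>T\<subseteq>W. countable T \<and> (\<forall>d\<in>W. (\<forall>i\<in>I - F. val (x i d) \<le> \<epsilon>) \<longrightarrow>
           (\<exists>t\<in>span T. \<forall>i\<in>I. val (x i (d - t)) \<le> \<epsilon>))"
  using assms(4,5)
proof (induction F rule: finite_induct)
  case empty
  have "\<exists>t\<in>span {}. \<forall>i\<in>I. val (x i (d - t)) \<le> \<epsilon>" if "\<forall>i\<in>I - {}. val (x i d) \<le> \<epsilon>" for d
    using that by simp
  then show ?case by (intro exI[of _ "{}"]) simp
next
  case (insert j F)
  then have jI: "j \<in> I" by simp
  obtain T where T: "T \<subseteq> W" "countable T"
    "\<And>d. d \<in> W \<Longrightarrow> \<forall>i\<in>I - F. val (x i d) \<le> \<epsilon> \<Longrightarrow> \<exists>t\<in>span T. \<forall>i\<in>I. val (x i (d - t)) \<le> \<epsilon>"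
    using insert.IH insert.prems by auto
  define M where "M = {d \<in> W. \<forall>i\<in>I - insert j F. val (x i d) \<le> \<epsilon>}"
  \<comment> \<open>Countably many members of \<open>M\<close> dominate all values of coordinate
    \<open>j\<close> on \<open>M\<close>, so an integral multiple of one of them matches any
    prescribed element of \<open>M\<close> at \<open>j\<close>.\<close>
  obtain C where C: "C \<subseteq> (\<lambda>d. val (x j d)) ` M" "countable C"
    "\<And>a. a \<in> (\<lambda>d. val (x j d)) ` M \<Longrightarrow> \<exists>c\<in>C. a \<le> c"
    using countable_cofinal_reals by blast
  obtain M' where M': "M' \<subseteq> M" "countable M'" "C = (\<lambda>d. val (x j d)) ` M'"
    using C(1,2) countable_subset_image[of C] by metis
  have "\<exists>t\<in>span (T \<union> M'). \<forall>i\<in>I. val (x i (d - t)) \<le> \<epsilon>"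
    if d: "d \<in> W" "\<forall>i\<in>I - insert j F. val (x i d) \<le> \<epsilon>" for d
  proof -
    have "d \<in> M" using d by (simp add: M_def)
    then obtain m where m: "m \<in> M'" "val (x j d) \<le> val (x j m)"
      using C(3) M'(3) by blast
    then have mW: "m \<in> W" and mM: "\<And>i. i \<in> I - insert j F \<Longrightarrow> val (x i m) \<le> \<epsilon>"
      using M'(1) by (auto simp: M_def)
    \<comment> \<open>As \<open>a\<close> is integral, subtracting \<open>a *s m\<close> clears
      coordinate \<open>j\<close> and keeps the coordinates outside \<open>insert j F\<close> small.
      If \<open>x j m = 0\<close>, then \<open>x j d = 0\<close> too, and division by zero yields
      the right value 0.\<close>
    define a where "a = x j d / x j m"
    have a: "val a \<le> 1"
      using m(2) val_ge_0[of "x j m"]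
      by (cases "val (x j m) = 0") (auto simp: a_def val_divide divide_le_eq_1 simp del: val_ge_0)
    have xa: "x j d = a * x j m"
      using m(2) val_ge_0[of "x j d"] val_eq_0_iff[of "x j d"] by (cases "x j m = 0") (auto simp: a_def)
    let ?d = "d - a *s m"
    have amW: "a *s m \<in> W" using mW W by (simp add: subspace_scale)
    have dW: "?d \<in> W" using d amW W by (simp add: subspace_diff)
    have x_d: "x i ?d = x i d - a * x i m" if "i \<in> I" for i
      using coords_diff[OF x W that d(1) amW] coords_scale[OF x that mW] by simp
    have "val (x i ?d) \<le> \<epsilon>" if i: "i \<in> I - F" for i
    proof (cases "i = j")
      case True
      then show ?thesis using x_d[OF jI] xa \<epsilon> by simp
    next
      case False
      have "val (a * x i m) \<le> val (x i m)"
        using a by (simp add: val_mult mult_left_le_one_le)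
      then show ?thesis
        using False i d(2) mM[of i] val_diff_le_max[of "x i d" "a * x i m"] x_d[of i] by force
    qed
    then obtain t where t: "t \<in> span T" "\<forall>i\<in>I. val (x i (?d - t)) \<le> \<epsilon>"
      using T(3)[OF dW] by blast
    have "a *s m + t \<in> span (T \<union> M')"
      using t(1) m(1) span_mono[of T "T \<union> M'"] by (intro span_add span_scale) (auto intro: span_base)
    moreover have "d - (a *s m + t) = ?d - t" by (simp add: algebra_simps)
    ultimately show ?thesis using t(2) by metis
  qed
  moreover have "T \<union> M' \<subseteq> W" "countable (T \<union> M')"
    using T M' by (auto simp: M_def)
  ultimately show ?case by blast
qed

text \<open>
  \<open>T\<close> is closed off under \<open>coords_countable_generators\<close>, where \<open>F\<close> ranges over the finite sets of
  coordinates that occur in \<open>T\<close> itself.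
\<close>

lemma coords_countable_closure:
  assumes x: "coords W B I x" and W: "subspace W" and w: "w \<in> W"
  obtains T where "T \<subseteq> W" "countable T" "w \<in> T"
    "\<And>d n. d \<in> W \<Longrightarrow> (\<And>i. i \<in> I \<Longrightarrow> \<forall>t\<in>T. x i t = 0 \<Longrightarrow> val (x i d) \<le> 1 / real (Suc n)) \<Longrightarrow>
       \<exists>t\<in>span T. \<forall>i\<in>I. val (x i (d - t)) \<le> 1 / real (Suc n)"
proof -
  have "\<exists>T\<subseteq>W. countable T \<and> (\<forall>d\<in>W. (\<forall>i\<in>I - F. val (x i d) \<le> 1 / real (Suc n)) \<longrightarrow>
           (\<exists>t\<in>span T. \<forall>i\<in>I. val (x i (d - t)) \<le> 1 / real (Suc n)))" if "finite F" "F \<subseteq> I" for F n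
    using coords_countable_generators[OF x W, of "1 / real (Suc n)"] that by simp
  then obtain G where G: "\<And>F n. finite F \<Longrightarrow> F \<subseteq> I \<Longrightarrow> G F n \<subseteq> W \<and> countable (G F n) \<and>
      (\<forall>d\<in>W. (\<forall>i\<in>I - F. val (x i d) \<le> 1 / real (Suc n)) \<longrightarrow>
           (\<exists>t\<in>span (G F n). \<forall>i\<in>I. val (x i (d - t)) \<le> 1 / real (Suc n)))"
    by metis
  \<comment> \<open>The coordinates occurring in \<open>T\<close>. A vector has only countably many
    nonzero coordinates, so a countable \<open>T\<close> leads to countably many finite sets
    \<open>F\<close> to be served.\<close>
  define Y where "Y T = {i \<in> I. \<exists>t\<in>T. x i t \<noteq> 0}" for T
  have Y: "countable (Y T)" if "T \<subseteq> W" "countable T" for T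
  proof -
    have "countable {i \<in> I. x i t \<noteq> 0}" if "t \<in> T" for t
    proof -
      have "{i \<in> I. x i t \<noteq> 0} \<subseteq> (\<Union>n. {i \<in> I. 1 / real (Suc n) \<le> val (x i t)})"
      proof
        fix i assume "i \<in> {i \<in> I. x i t \<noteq> 0}"
        then have "i \<in> I" "0 < val (x i t)"
          using val_ge_0[of "x i t"] val_eq_0_iff[of "x i t"] by (auto simp del: val_ge_0)
        moreover obtain n where "1 / real (Suc n) < val (x i t)"
          using \<open>0 < val (x i t)\<close> by (rule nat_approx_posE)
        ultimately show "i \<in> (\<Union>n. {i \<in> I. 1 / real (Suc n) \<le> val (x i t)})"
          by (auto intro: less_imp_le)
      qed
      moreover have "countable (\<Union>n. {i \<in> I. 1 / real (Suc n) \<le> val (x i t)})"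
      proof (rule countable_UN)
        show "countable {i \<in> I. 1 / real (Suc n) \<le> val (x i t)}" for n
          using coords_finite[OF x, of t "1 / real (Suc n)"] that \<open>T \<subseteq> W\<close>
          by (intro countable_finite) auto
      qed simp
      ultimately show ?thesis by (rule countable_subset)
    qed
    moreover have "Y T = (\<Union>t\<in>T. {i \<in> I. x i t \<noteq> 0})"
      by (auto simp: Y_def)
    ultimately show ?thesis using that(2) by simp
  qed
  define H where "H T = T \<union> (\<Union>F\<in>{F. finite F \<and> F \<subseteq> Y T}. \<Union>n. G F n)" for T
  define S where "S n = (H ^^ n) {w}" for n
  have S_Suc: "S (Suc n) = H (S n)" for n
    by (simp add: S_def)
  have YI: "Y T \<subseteq> I" for T
    by (auto simp: Y_def)
  have S: "S n \<subseteq> W \<and> countable (S n)" for n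
  proof (induction n)
    case 0
    then show ?case using w by (simp add: S_def)
  next
    case (Suc n)
    then have "countable {F. finite F \<and> F \<subseteq> Y (S n)}"
      using countable_Collect_finite_subset[OF Y] by simp
    moreover have "G F m \<subseteq> W \<and> countable (G F m)" if "finite F" "F \<subseteq> Y (S n)" for F m
      using G[of F m] that YI by blast
    ultimately show ?case
      using Suc unfolding S_Suc H_def by (auto intro!: countable_UN)
  qed
  define T where "T = (\<Union>n. S n)"
  have Ymono: "Y (S m) \<subseteq> Y (S n)" if "m \<le> n" for m n
  proof -
    have "S m \<subseteq> S n"
      by (rule lift_Suc_mono_le[of S, OF _ that]) (auto simp: S_Suc H_def)
    then show ?thesis by (auto simp: Y_def)
  qed
  have YT: "Y T = (\<Union>n. Y (S n))"
    by (auto simp: Y_def T_def)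
  show ?thesis
  proof (rule that[of T])
    show "T \<subseteq> W" "countable T"
      using S by (auto simp: T_def)
    have "w \<in> S 0" by (simp add: S_def)
    then show "w \<in> T" unfolding T_def by blast
  next
    fix d n assume d: "d \<in> W" and small: "\<And>i. i \<in> I \<Longrightarrow> \<forall>t\<in>T. x i t = 0 \<Longrightarrow> val (x i d) \<le> 1 / real (Suc n)"
    \<comment> \<open>Coordinates outside \<open>Y T\<close> are small by assumption, which leaves
      the finite set \<open>F\<close>. It already occurs at some stage \<open>S m\<close>, and its
      generators enter at the next stage.\<close>
    define F where "F = {i \<in> Y T. 1 / real (Suc n) \<le> val (x i d)}"
    have F: "finite F" "F \<subseteq> I"
      using coords_finite[OF x d, of "1 / real (Suc n)"] YI[of T] by (auto simp: F_def elim: rev_finite_subset)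
    have "F \<subseteq> (\<Union>n. Y (S n))"
      using YT by (auto simp: F_def)
    then obtain m where m: "F \<subseteq> Y (S m)"
    proof -
      have "subset.chain UNIV (range (\<lambda>n. Y (S n)))"
        using Ymono nat_le_linear unfolding subset_chain_def by (metis UNIV_I rangeE subsetI)
      then show ?thesis
        using finite_subset_Union_chain[OF F(1) \<open>F \<subseteq> (\<Union>n. Y (S n))\<close>] that by blast
    qed
    have "G F n \<subseteq> S (Suc m)"
      using F m unfolding S_Suc H_def by blast
    then have GT: "span (G F n) \<subseteq> span T"
      by (intro span_mono) (auto simp: T_def)
    have "\<forall>i\<in>I - F. val (x i d) \<le> 1 / real (Suc n)"
    proof
      fix i assume i: "i \<in> I - F"
      show "val (x i d) \<le> 1 / real (Suc n)"
        using i small[of i] by (cases "i \<in> Y T") (auto simp: F_def Y_def)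
    qed
    then obtain t where "t \<in> span (G F n)" "\<forall>i\<in>I. val (x i (d - t)) \<le> 1 / real (Suc n)"
      using G[OF F, of n] d by blast
    then show "\<exists>t\<in>span T. \<forall>i\<in>I. val (x i (d - t)) \<le> 1 / real (Suc n)"
      using GT by blast
  qed
qed

text \<open>Gruson's theorem, relative to a partial basis \<open>B\<close>.\<close>

theorem onb_extension:
  assumes W: "subspace W" "closed W" and B: "B \<subseteq> W" "orthonormal B" and x: "coords W B I x"
  obtains B' where "B \<subseteq> B'" "onb W B'"
proof -
  define J where "J A = {i \<in> I. \<forall>b\<in>A. x i b = 0}" for A
  define \<A> where "\<A> = {A. B \<subseteq> A \<and> A \<subseteq> W \<and> orthonormal A \<and> coords W A (J A) x}"
  have J_anti: "A \<subseteq> A' \<Longrightarrow> J A' \<subseteq> J A" for A A'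
    by (auto simp: J_def)
  have coords_A: "coords W A (J A) x"
    if "\<And>u n. u \<in> W \<Longrightarrow> \<forall>i\<in>J A. val (x i u) \<le> 1 / real (Suc n) \<Longrightarrow>
          \<exists>m\<in>closed_span A. \<parallel>u - m\<parallel> \<le> 1 / real (Suc n)" for A
    by (rule coords_change[OF x _ _ that]) (auto simp: J_def)
  have "\<exists>M\<in>\<A>. \<forall>A\<in>\<A>. M \<subseteq> A \<longrightarrow> A = M"
  proof (rule subset_Zorn_nonempty)
    have "J B = I"
      using coords_zero[OF x] by (auto simp: J_def)
    then have "B \<in> \<A>"
      using B x by (simp add: \<A>_def)
    then show "\<A> \<noteq> {}" by blast
  next
    fix \<C> assume ne: "\<C> \<noteq> {}" and chain: "subset.chain \<A> \<C>"
    then have sub: "\<C> \<subseteq> \<A>" and chain': "subset.chain UNIV \<C>"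
      by (auto simp: subset_chain_def)
    have "coords W (\<Union>\<C>) (J (\<Union>\<C>)) x"
    proof (rule coords_A)
      fix u n assume u: "u \<in> W" and small: "\<forall>i\<in>J (\<Union>\<C>). val (x i u) \<le> 1 / real (Suc n)"
      \<comment> \<open>Only finitely many coordinates are large at \<open>u\<close> and fail to
        vanish on the union. A single member of the chain already excludes them all, and its
        approximation property applies.\<close>
      define F where "F = {i \<in> I. 1 / real (Suc n) \<le> val (x i u) \<and> i \<notin> J (\<Union>\<C>)}"
      have F: "finite F"
        by (rule finite_subset[OF _ coords_finite[OF x u, of "1 / real (Suc n)"]]) (auto simp: F_def)
      have "F \<subseteq> \<Union>((\<lambda>A. I - J A) ` \<C>)"
        by (auto simp: F_def J_def)
      moreover have "subset.chain UNIV ((\<lambda>A. I - J A) ` \<C>)"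
        unfolding subset_chain_def
      proof (intro conjI ballI subset_UNIV)
        fix S S' assume "S \<in> (\<lambda>A. I - J A) ` \<C>" "S' \<in> (\<lambda>A. I - J A) ` \<C>"
        then obtain A A' where "A \<in> \<C>" "S = I - J A" "A' \<in> \<C>" "S' = I - J A'" by auto
        moreover have "A \<subseteq> A' \<or> A' \<subseteq> A"
          using chain' \<open>A \<in> \<C>\<close> \<open>A' \<in> \<C>\<close> by (auto simp: subset_chain_def)
        ultimately show "S \<subseteq> S' \<or> S' \<subseteq> S"
          using J_anti by blast
      qed
      ultimately obtain S where "S \<in> (\<lambda>A. I - J A) ` \<C>" "F \<subseteq> S"
        using finite_subset_Union_chain[OF F, of "(\<lambda>A. I - J A) ` \<C>"] ne by blast
      then obtain A where A: "A \<in> \<C>" "F \<subseteq> I - J A" by blast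
      have "val (x i u) \<le> 1 / real (Suc n)" if "i \<in> J A" for i
      proof (cases "i \<in> J (\<Union>\<C>)")
        case False
        have "i \<in> I" "i \<notin> F" using that A(2) by (auto simp: J_def)
        with False show ?thesis by (simp add: F_def)
      qed (use small in blast)
      moreover have "coords W A (J A) x"
        using A sub by (auto simp: \<A>_def)
      ultimately obtain m where "m \<in> closed_span A" "\<parallel>u - m\<parallel> \<le> 1 / real (Suc n)"
        using coords_approx[OF _ u] by blast
      then show "\<exists>m\<in>closed_span (\<Union>\<C>). \<parallel>u - m\<parallel> \<le> 1 / real (Suc n)"
        using closed_span_mono[of A "\<Union>\<C>"] A by blast
    qed
    moreover have "orthonormal (\<Union>\<C>)"
      using sub by (intro orthonormal_Union_chain[OF ne chain']) (auto simp: \<A>_def)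
    ultimately show "\<Union>\<C> \<in> \<A>"
      using sub ne by (auto simp: \<A>_def)
  qed
  then obtain M where M: "M \<in> \<A>" and max: "\<And>A. A \<in> \<A> \<Longrightarrow> M \<subseteq> A \<Longrightarrow> A = M"
    by blast
  then have M': "B \<subseteq> M" "M \<subseteq> W" "orthonormal M" and xM: "coords W M (J M) x"
    by (auto simp: \<A>_def)
  have "W \<subseteq> closed_span M"
  proof
    fix w assume w: "w \<in> W"
    obtain T where T: "T \<subseteq> W" "countable T" "w \<in> T"
      "\<And>d n. d \<in> W \<Longrightarrow> (\<And>i. i \<in> J M \<Longrightarrow> \<forall>t\<in>T. x i t = 0 \<Longrightarrow> val (x i d) \<le> 1 / real (Suc n)) \<Longrightarrow>
         \<exists>t\<in>span T. \<forall>i\<in>J M. val (x i (d - t)) \<le> 1 / real (Suc n)"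
      using coords_countable_closure[OF xM W(1) w] by blast
    obtain A where A: "M \<subseteq> A" "A \<subseteq> W" "orthonormal A" "T \<subseteq> closed_span A" "A \<subseteq> closed_span (M \<union> T)"
      using coords_insert_countable[OF W M'(2,3) xM T(1,2)] by blast
    \<comment> \<open>\<open>A\<close> and \<open>M \<union> T\<close> have the same closed span and
      hence the same vanishing coordinates. If \<open>u\<close> is small at these, a vector of
      \<open>span T\<close> corrects it to be small on all of \<open>J M\<close>, and the rest is
      approximated from \<open>closed_span M\<close>.\<close>
    have "coords W A (J A) x"
    proof (rule coords_A)
      fix u n assume u: "u \<in> W" and small: "\<forall>i\<in>J A. val (x i u) \<le> 1 / real (Suc n)"
      have "val (x i u) \<le> 1 / real (Suc n)" if "i \<in> J M" "\<forall>t\<in>T. x i t = 0" for i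
      proof -
        have i: "i \<in> I" "\<And>b. b \<in> M \<union> T \<Longrightarrow> x i b = 0"
          using that by (auto simp: J_def)
        have "x i a = 0" if "a \<in> A" for a
          using coords_vanish_closed_span[OF x W i(1) _ i(2), of "M \<union> T" a] that A(5) M'(2) T(1) by auto
        then show ?thesis using small i by (simp add: J_def)
      qed
      then obtain t where t: "t \<in> span T" "\<forall>i\<in>J M. val (x i (u - t)) \<le> 1 / real (Suc n)"
        using T(4)[OF u, of n] by metis
      have "u - t \<in> W"
        using t(1) u subspace_diff[OF W(1)] span_minimal[OF T(1) W(1)] by blast
      then obtain m where m: "m \<in> closed_span M" "\<parallel>u - t - m\<parallel> \<le> 1 / real (Suc n)"
        using coords_approx[OF xM, of "u - t" n] t(2) by blast
      have "t \<in> closed_span A" "m \<in> closed_span A"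
        using t(1) span_minimal[OF A(4) subspace_closed_span] m(1) closed_span_mono[OF A(1)] by auto
      then have "t + m \<in> closed_span A"
        by (simp add: subspace_add)
      then show "\<exists>m\<in>closed_span A. \<parallel>u - m\<parallel> \<le> 1 / real (Suc n)"
        using m(2) by (intro bexI[of _ "t + m"]) (simp_all add: diff_diff_eq)
    qed
    then have "A \<in> \<A>"
      using A M' by (auto simp: \<A>_def)
    then have "A = M" using max A(1) by blast
    then show "w \<in> closed_span M" using A(4) T(3) by blast
  qed
  then have "closed_span M = W"
    using closed_span_minimal[OF M'(2) W] by blast
  then show ?thesis
    using that[of M] M' by (simp add: onb_def)
qed

end

section \<open>Orthonormal Schauder bases\<close>

context banach_vector_space
begin

section \<open>Coordinate functionals of an orthonormal basis\<close>

lemma orthonormal_independent: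
  assumes "orthonormal B"
  shows "independent B"
proof
  assume "dependent B"
  then obtain F c a where F: "finite F" "F \<subseteq> B" "(\<Sum>v\<in>F. c v *s v) = 0" "a \<in> F" "c a \<noteq> 0"
    unfolding dependent_explicit by blast
  then have "val (c a) \<le> 0"
    using orthonormalD[OF assms F(1,2,4), of c] by simp
  then show False
    using F(5) val_ge_0[of "c a"] val_eq_0_iff[of "c a"] by linarith
qed

text \<open>Orthonormality bounds each coefficient by the norm. If all of the finitely many nonzero
  ones were strictly smaller, so would be the sum.\<close>

lemma orthonormal_representation:
  assumes B: "orthonormal B" and s: "s \<in> span B"
  shows representation_le_nrm: "val (representation B s b) \<le> \<parallel>s\<parallel>"
    and representation_nrm: "s \<noteq> 0 \<Longrightarrow> \<exists>b\<in>B. val (representation B s b) = \<parallel>s\<parallel>"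
proof -
  note ind = orthonormal_independent[OF B]
  let ?F = "{b. representation B s b \<noteq> 0}"
  have F: "finite ?F" "?F \<subseteq> B"
    using finite_representation representation_ne_zero by auto
  have sum: "(\<Sum>b\<in>?F. representation B s b *s b) = s"
    by (rule sum_nonzero_representation_eq[OF ind s])
  show le: "val (representation B s b) \<le> \<parallel>s\<parallel>" for b
    using orthonormalD[OF B F, of b "representation B s"] sum nrm_ge_0[of s]
    by (cases "b \<in> ?F") auto
  show "\<exists>b\<in>B. val (representation B s b) = \<parallel>s\<parallel>" if "s \<noteq> 0"
  proof (rule ccontr)
    assume "\<not> ?thesis"
    then have "val (representation B s b) < \<parallel>s\<parallel>" if "b \<in> B" for b
      using le[of b] that by fastforce
    moreover have "0 < \<parallel>s\<parallel>"
      using that nrm_ge_0[of s] nrm_eq_0_iff[of s] by linarith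
    ultimately have "\<parallel>\<Sum>b\<in>?F. representation B s b *s b\<parallel> < \<parallel>s\<parallel>"
      using F(2) ortho_modD1[OF B] by (intro nrm_sum_less) (auto simp: nrm_scale subset_iff)
    then show False using sum by simp
  qed
qed

text \<open>On \<open>span B\<close> the coefficient functions are contractions, so completeness of
  \<open>k\<close> extends them to the closure. The extension theorem yields only continuity; the
  algebraic rules are transferred by approximation.\<close>

lemma onb_coords:
  assumes "onb W B"
  shows "\<exists>x. coords W {} B x \<and> (\<forall>v\<in>W. v \<noteq> 0 \<longrightarrow> (\<exists>b\<in>B. val (x b v) = \<parallel>v\<parallel>)) \<and>
    (\<forall>a\<in>B. \<forall>b\<in>B. x b a = (if a = b then 1 else 0))"
proof -
  have B: "orthonormal B" and W: "W = closed_span B"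
    using assms by (auto simp: onb_def)
  note ind = orthonormal_independent[OF B]
  let ?r = "\<lambda>b v. representation B v b"
  have diff: "?r b (u - v) = ?r b u - ?r b v" if "u \<in> span B" "v \<in> span B" for b u v
    using representation_diff[OF ind that(2,1)] by simp
  have "\<exists>g. continuous_on (closure (span B)) g \<and> (\<forall>s\<in>span B. ?r b s = g s)" for b
  proof -
    have "uniformly_continuous_on (span B) (?r b)"
      unfolding uniformly_continuous_on_def
    proof (intro allI impI)
      fix \<epsilon> :: real assume "0 < \<epsilon>"
      moreover have "dist (?r b u) (?r b v) \<le> dist u v" if "u \<in> span B" "v \<in> span B" for u v
        using representation_le_nrm[OF B span_diff[OF that], of b] that
        by (simp add: dist_val dist_nrm diff)
      ultimately show "\<exists>d>0. \<forall>u\<in>span B. \<forall>v\<in>span B. dist v u < d \<longrightarrow> dist (?r b v) (?r b u) < \<epsilon>"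
        by (meson order_le_less_trans)
    qed
    then show ?thesis
      using uniformly_continuous_on_extension_on_closure uniformly_continuous_imp_continuous by metis
  qed
  then obtain x where cont: "\<And>b. continuous_on (closure (span B)) (x b)"
    and x_span: "\<And>b s. s \<in> span B \<Longrightarrow> x b s = ?r b s"
    by metis
  have cl: "closure (span B) = W"
    by (simp add: W closed_span_def)
  have approx: "\<exists>s\<in>span B. \<parallel>v - s\<parallel> < \<epsilon> \<and> val (x b v - ?r b s) < \<epsilon>" if v: "v \<in> W" and \<epsilon>: "0 < \<epsilon>" for v b \<epsilon>
  proof -
    obtain d where d: "0 < d" "\<And>u. u \<in> W \<Longrightarrow> dist u v < d \<Longrightarrow> dist (x b u) (x b v) < \<epsilon>"
      using cont[of b] v \<epsilon> unfolding cl continuous_on_iff by metis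
    obtain s where s: "s \<in> span B" "\<parallel>v - s\<parallel> < min d \<epsilon>"
      using closed_spanE[of v B "min d \<epsilon>"] v d \<epsilon> W by auto
    then have "dist (x b s) (x b v) < \<epsilon>"
      using span_subset_closed_span[of B] by (intro d) (auto simp: W dist_nrm nrm_minus_commute)
    then show ?thesis
      using s x_span[OF s(1)] by (intro bexI[of _ s]) (auto simp: dist_commute dist_val[symmetric])
  qed
  \<comment> \<open>True up to any \<open>\<epsilon>\<close>, by comparison with a \<open>t\<close>
    in \<open>span B\<close> near \<open>v\<close>. This estimate replaces continuity in the rest of
    the proof.\<close>
  have le: "val (x b v - ?r b s) \<le> \<parallel>v - s\<parallel>" if v: "v \<in> W" and s: "s \<in> span B" for v s b
  proof (rule field_le_epsilon)
    fix \<epsilon> :: real assume \<epsilon>: "0 < \<epsilon>"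
    then obtain t where t: "t \<in> span B" "\<parallel>v - t\<parallel> < \<epsilon>" "val (x b v - ?r b t) < \<epsilon>"
      using approx[OF v] by blast
    have "val (?r b t - ?r b s) \<le> \<parallel>t - s\<parallel>"
      using representation_le_nrm[OF B span_diff[OF t(1) s], of b] diff[OF t(1) s] by simp
    moreover have "\<parallel>t - s\<parallel> \<le> max \<parallel>v - t\<parallel> \<parallel>v - s\<parallel>"
      using nrm_diff_le_max[of "v - s" "v - t"] by simp
    moreover have "val (x b v - ?r b s) \<le> max (val (x b v - ?r b t)) (val (?r b t - ?r b s))"
      using val_add_le_max[of "x b v - ?r b t" "?r b t - ?r b s"] by simp
    ultimately show "val (x b v - ?r b s) \<le> \<parallel>v - s\<parallel> + \<epsilon>"
      using t \<epsilon> nrm_ge_0[of "v - s"] by (simp add: max_def split: if_splits)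
  qed
  have le_nrm: "val (x b v) \<le> \<parallel>v\<parallel>" if "v \<in> W" for b v
    using le[OF that span_zero] by (simp add: representation_zero)
  \<comment> \<open>A nonzero defect would serve as the tolerance for approximating both vectors
    from \<open>span B\<close>, where the rule is exact; the same works for scalars.\<close>
  have add: "x b (u + v) = x b u + x b v" if uv: "u \<in> W" "v \<in> W" for b u v
  proof (rule ccontr)
    let ?d = "x b (u + v) - (x b u + x b v)"
    assume "x b (u + v) \<noteq> x b u + x b v"
    then have pos: "0 < val ?d"
      using val_ge_0[of ?d] val_eq_0_iff[of ?d] by (simp del: val_ge_0)
    obtain s where s: "s \<in> span B" "\<parallel>u - s\<parallel> < val ?d"
      using closed_spanE[of u B] uv(1) pos unfolding W by blast
    obtain t where t: "t \<in> span B" "\<parallel>v - t\<parallel> < val ?d"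
      using closed_spanE[of v B] uv(2) pos unfolding W by blast
    have uvW: "u + v \<in> W" using uv by (simp add: W subspace_add)
    have "\<parallel>(u + v) - (s + t)\<parallel> < val ?d"
      using nrm_add_le_max[of "u - s" "v - t"] s t by (simp add: algebra_simps)
    then have 1: "val (x b (u + v) - ?r b (s + t)) < val ?d"
      using le[OF uvW span_add[OF s(1) t(1)], of b] by linarith
    have 2: "val (x b u - ?r b s) < val ?d" "val (x b v - ?r b t) < val ?d"
      using le[OF uv(1) s(1), of b] le[OF uv(2) t(1), of b] s t by linarith+
    have "?r b (s + t) = ?r b s + ?r b t"
      using representation_add[OF ind t(1) s(1)] by simp
    then have "?d = (x b (u + v) - ?r b (s + t)) - ((x b u - ?r b s) + (x b v - ?r b t))"
      by (simp add: algebra_simps)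
    then have "val ?d \<le> max (val (x b (u + v) - ?r b (s + t)))
        (max (val (x b u - ?r b s)) (val (x b v - ?r b t)))"
      using val_diff_le_max val_add_le_max by (smt (verit))
    then show False using 1 2 by linarith
  qed
  have scale: "x b (c *s u) = c * x b u" if u: "u \<in> W" for b u c
  proof (rule ccontr)
    let ?d = "x b (c *s u) - c * x b u"
    assume "x b (c *s u) \<noteq> c * x b u"
    then have pos: "0 < val ?d"
      using val_ge_0[of ?d] val_eq_0_iff[of ?d] by (simp del: val_ge_0)
    have pos': "0 < val c + 1"
      using val_ge_0[of c] by linarith
    obtain s where s: "s \<in> span B" "\<parallel>u - s\<parallel> < val ?d / (val c + 1)"
      using closed_spanE[of u B "val ?d / (val c + 1)"] u divide_pos_pos[OF pos pos'] unfolding W by blast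
    have small: "val c * r < val ?d" if "r \<le> \<parallel>u - s\<parallel>" "0 \<le> r" for r
    proof -
      have "val c * r \<le> (val c + 1) * r" using that by (simp add: algebra_simps)
      also have "\<dots> \<le> (val c + 1) * \<parallel>u - s\<parallel>" using that pos' by (intro mult_left_mono) auto
      also have "\<dots> < val ?d" using s(2) pos' by (simp add: field_simps)
      finally show ?thesis .
    qed
    have "\<parallel>c *s u - c *s s\<parallel> = val c * \<parallel>u - s\<parallel>"
      by (simp add: nrm_scale flip: scale_right_diff_distrib)
    moreover have "c *s u \<in> W" using u by (simp add: W subspace_scale)
    ultimately have "val (x b (c *s u) - ?r b (c *s s)) < val ?d"
      using le[of "c *s u" "c *s s" b] span_scale[OF s(1)] small[of "\<parallel>u - s\<parallel>"] nrm_ge_0[of "u - s"] by simp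
    moreover have "val (c * (x b u - ?r b s)) < val ?d"
      using small[of "val (x b u - ?r b s)"] le[OF u s(1)] by (simp add: val_mult)
    moreover have "?r b (c *s s) = c * ?r b s"
      using representation_scale[OF ind s(1)] by simp
    then have "?d = (x b (c *s u) - ?r b (c *s s)) - c * (x b u - ?r b s)"
      by (simp add: algebra_simps)
    ultimately show False
      using val_diff_le_max[of "x b (c *s u) - ?r b (c *s s)" "c * (x b u - ?r b s)"] by simp
  qed
  \<comment> \<open>A vector of \<open>span B\<close> closer to \<open>v\<close> than the norm of
    \<open>v\<close> has that norm too, and the value of its largest coefficient survives the
    passage to \<open>v\<close>.\<close>
  have nrm: "\<exists>b\<in>B. val (x b v) = \<parallel>v\<parallel>" if v: "v \<in> W" "v \<noteq> 0" for v
  proof -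
    have "0 < \<parallel>v\<parallel>"
      using v(2) nrm_ge_0[of v] nrm_eq_0_iff[of v] by linarith
    then obtain s where s: "s \<in> span B" "\<parallel>v - s\<parallel> < \<parallel>v\<parallel>"
      using closed_spanE[of v B] v(1) unfolding W by blast
    then have sv: "\<parallel>s\<parallel> = \<parallel>v\<parallel>"
      by (intro nrm_eq_if_close)
    then obtain b where b: "b \<in> B" "val (?r b s) = \<parallel>s\<parallel>"
      using representation_nrm[OF B s(1)] v(2) nrm_eq_0_iff by metis
    have "val (x b v - ?r b s) < \<parallel>v\<parallel>"
      using le[OF v(1) s(1), of b] s by linarith
    then have "\<parallel>v\<parallel> \<le> val (x b v)"
      using val_diff_le_max[of "x b v" "x b v - ?r b s"] b sv by simp
    then show ?thesis
      using le_nrm[OF v(1), of b] b by (intro bexI[of _ b]) auto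
  qed
  have fin: "finite {b \<in> B. \<epsilon> \<le> val (x b u)}" if u: "u \<in> W" and \<epsilon>: "0 < \<epsilon>" for u \<epsilon>
  proof -
    obtain s where s: "s \<in> span B" "\<parallel>u - s\<parallel> < \<epsilon>"
      using closed_spanE[of u B] u \<epsilon> unfolding W by blast
    have "{b \<in> B. \<epsilon> \<le> val (x b u)} \<subseteq> {b. ?r b s \<noteq> 0}"
    proof
      fix b assume b: "b \<in> {b \<in> B. \<epsilon> \<le> val (x b u)}"
      show "b \<in> {b. ?r b s \<noteq> 0}"
        using le[OF u s(1), of b] s(2) b by auto
    qed
    then show ?thesis
      using finite_representation finite_subset by blast
  qed
  have "coords W {} B x"
    unfolding coords_def
  proof (intro conjI ballI allI impI)
    fix u n assume u: "u \<in> W" and small: "\<forall>b\<in>B. val (x b u) \<le> 1 / real (Suc n)"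
    have "\<parallel>u - 0\<parallel> \<le> 1 / real (Suc n)"
      using nrm[OF u] small by (cases "u = 0") auto
    moreover have "0 \<in> closed_span {}"
      by (simp add: subspace_0)
    ultimately show "\<exists>m\<in>closed_span {}. \<parallel>u - m\<parallel> \<le> 1 / real (Suc n)"
      by blast
  qed (use le_nrm add scale fin in auto)
  moreover have "x b a = (if a = b then 1 else 0)" if "a \<in> B" "b \<in> B" for a b
    using x_span[OF span_base[OF that(1)], of b] representation_basis[OF ind that(1)] by simp
  ultimately show ?thesis using nrm by blast
qed

lemma coords_sum:
  assumes x: "coords W B I x" and W: "subspace W" and i: "i \<in> I" and F: "\<And>a. a \<in> F \<Longrightarrow> f a \<in> W"
  shows "x i (sum f F) = (\<Sum>a\<in>F. x i (f a))"
proof -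
  have "x i 0 = 0"
    using coords_scale[OF x i subspace_0[OF W], of 0] by simp
  then show ?thesis
    using F
  proof (induction F rule: infinite_finite_induct)
    case (insert a F)
    then show ?case using coords_add[OF x i, of "f a" "sum f F"] subspace_sum[OF W, of F f] by simp
  qed simp_all
qed

lemma coords_dual_sum:
  assumes x: "coords W B' B x" and W: "subspace W" and B: "B \<subseteq> W"
    and dual: "\<And>a b. a \<in> B \<Longrightarrow> b \<in> B \<Longrightarrow> x b a = (if a = b then 1 else 0)"
    and b: "b \<in> B" and F: "finite F" "F \<subseteq> B"
  shows "x b (\<Sum>a\<in>F. c a *s a) = (if b \<in> F then c b else 0)"
proof -
  have "x b (\<Sum>a\<in>F. c a *s a) = (\<Sum>a\<in>F. x b (c a *s a))"
    using F(2) B subspace_scale[OF W] by (intro coords_sum[OF x W b]) blast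
  also have "\<dots> = (\<Sum>a\<in>F. if a = b then c b else 0)"
  proof (rule sum.cong)
    fix a assume "a \<in> F"
    then have "a \<in> B" "a \<in> W" using F(2) B by auto
    then show "x b (c a *s a) = (if a = b then c b else 0)"
      using coords_scale[OF x b, of a "c a"] dual[OF _ b, of a] by auto
  qed simp
  finally show ?thesis using F(1) by simp
qed

text \<open>The remainder has no coordinates in \<open>F\<close> and small ones elsewhere; as
  \<open>closed_span {} = {0}\<close>, the approximation clause of \<open>coords\<close> becomes a
  bound on its norm.\<close>

lemma onb_expansion:
  assumes W: "onb W B" and x: "coords W {} B x" and dual: "\<And>a b. a \<in> B \<Longrightarrow> b \<in> B \<Longrightarrow> x b a = (if a = b then 1 else 0)"
    and v: "v \<in> W"
    and F: "finite F" "F \<subseteq> B" "\<And>b. b \<in> B - F \<Longrightarrow> val (x b v) \<le> 1 / real (Suc n)"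
  shows "\<parallel>v - (\<Sum>b\<in>F. x b v *s b)\<parallel> \<le> 1 / real (Suc n)"
proof -
  have sub: "subspace W" and BW: "B \<subseteq> W"
    using W closed_span_superset by (auto simp: onb_def)
  have in_W: "x b v *s b \<in> W" if "b \<in> F" for b
    using that F BW subspace_scale[OF sub] by blast
  let ?s = "\<Sum>b\<in>F. x b v *s b"
  have s: "?s \<in> W"
    using subspace_sum[OF sub in_W] .
  have "x b (v - ?s) = (if b \<in> F then 0 else x b v)" if b: "b \<in> B" for b
    using coords_diff[OF x sub b v s] coords_dual_sum[OF x sub BW dual b F(1,2), of "\<lambda>b. x b v"] by simp
  then have "\<exists>m\<in>closed_span {}. \<parallel>(v - ?s) - m\<parallel> \<le> 1 / real (Suc n)"
    using F(3) by (intro coords_approx[OF x subspace_diff[OF sub v s]]) simp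
  moreover have "closed_span {} = {0}"
    by (simp add: closed_span_def)
  ultimately show ?thesis by simp
qed

text \<open>If the coordinates outside \<open>C\<close> are small, truncating the expansion leaves
  only terms from \<open>C\<close>. This provides the relative coordinates with which
  \<open>pure_exists\<close> extends part of a basis.\<close>

lemma onb_coords_subset:
  assumes W: "onb W B" and C: "C \<subseteq> B"
  obtains x where "coords W C (B - C) x"
proof -
  obtain x where x: "coords W {} B x"
    and nrm: "\<forall>v\<in>W. v \<noteq> 0 \<longrightarrow> (\<exists>b\<in>B. val (x b v) = \<parallel>v\<parallel>)"
    and dual': "\<forall>a\<in>B. \<forall>b\<in>B. x b a = (if a = b then 1 else 0)"
    using onb_coords[OF W] by (elim exE conjE) (rule that)
  have dual: "x b a = (if a = b then 1 else 0)" if "a \<in> B" "b \<in> B" for a b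
    using dual' that by blast
  have "\<exists>m\<in>closed_span C. \<parallel>u - m\<parallel> \<le> 1 / real (Suc n)"
    if u: "u \<in> W" and small: "\<forall>i\<in>B - C. val (x i u) \<le> 1 / real (Suc n)" for u n
  proof -
    define F where "F = {b \<in> B. 1 / real (Suc n) \<le> val (x b u)} \<inter> C"
    have F: "finite F" "F \<subseteq> B" "F \<subseteq> C"
      using coords_finite[OF x u, of "1 / real (Suc n)"] by (auto simp: F_def)
    have "\<parallel>u - (\<Sum>b\<in>F. x b u *s b)\<parallel> \<le> 1 / real (Suc n)"
    proof (rule onb_expansion[OF W x dual u F(1,2)])
      show "val (x b u) \<le> 1 / real (Suc n)" if "b \<in> B - F" for b
        using that small by (cases "b \<in> C") (auto simp: F_def)
    qed auto
    moreover have "(\<Sum>b\<in>F. x b u *s b) \<in> closed_span C"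
      using F(3) by (intro subsetD[OF span_subset_closed_span] span_sum span_scale span_base) auto
    ultimately show ?thesis by blast
  qed
  then have "coords W C (B - C) x"
    using dual C by (intro coords_change[OF x]) auto
  then show ?thesis using that by blast
qed

lemma onb_has_sum:
  assumes W: "onb W B" and x: "coords W {} B x" and dual: "\<And>a b. a \<in> B \<Longrightarrow> b \<in> B \<Longrightarrow> x b a = (if a = b then 1 else 0)"
    and v: "v \<in> W"
  shows "((\<lambda>b. x b v *s b) has_sum v) B"
  unfolding has_sum_def tendsto_iff
proof (intro allI impI)
  fix \<epsilon> :: real assume "0 < \<epsilon>"
  then obtain n where n: "1 / real (Suc n) < \<epsilon>"
    by (rule nat_approx_posE)
  let ?F = "{b \<in> B. 1 / real (Suc n) \<le> val (x b v)}"
  have "finite ?F"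
    using coords_finite[OF x v, of "1 / real (Suc n)"] by simp
  moreover have "dist (\<Sum>b\<in>G. x b v *s b) v < \<epsilon>" if "finite G" "?F \<subseteq> G" "G \<subseteq> B" for G
    using onb_expansion[OF W x dual v that(1,3), of n] that n
    by (force simp: dist_nrm nrm_minus_commute[of _ v] not_le intro: less_imp_le)
  ultimately show "\<forall>\<^sub>F G in finite_subsets_at_top B. dist (\<Sum>b\<in>G. x b v *s b) v < \<epsilon>"
    unfolding eventually_finite_subsets_at_top by (intro exI[of _ ?F]) auto
qed

lemma onb_imp_orthonormal_schauder_basis:
  assumes W: "onb W B"
  shows "orthonormal_schauder_basis W B"
proof -
  have B: "orthonormal B" and W': "W = closed_span B"
    using W by (auto simp: onb_def)
  have BW: "B \<subseteq> W" and sub: "subspace W"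
    using closed_span_superset by (auto simp: W')
  obtain x where x: "coords W {} B x"
    and nrm: "\<forall>v\<in>W. v \<noteq> 0 \<longrightarrow> (\<exists>b\<in>B. val (x b v) = \<parallel>v\<parallel>)"
    and dual': "\<forall>a\<in>B. \<forall>b\<in>B. x b a = (if a = b then 1 else 0)"
    using onb_coords[OF W] by (elim exE conjE) (rule that)
  have dual: "x b a = (if a = b then 1 else 0)" if "a \<in> B" "b \<in> B" for a b
    using dual' that by blast
  \<comment> \<open>Completeness of the space enters here: truncations of the formal sum are Cauchy,
    since norms are attained at coordinates and \<open>s m - s n\<close> has none left in
    \<open>F N\<close>.\<close>
  have ex: "\<exists>v\<in>W. \<forall>b\<in>B. x b v = c b" if c: "c \<in> C0 B" for c
  proof -
    define F where "F n = {b \<in> B. 1 / real (Suc n) \<le> val (c b)}" for n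
    have F: "finite (F n)" "F n \<subseteq> B" for n
      using c by (auto simp: F_def C0_def)
    define s where "s n = (\<Sum>b\<in>F n. c b *s b)" for n
    have in_W: "c b *s b \<in> W" if "b \<in> B" for b
      using that BW subspace_scale[OF sub] by blast
    have s: "s n \<in> W" for n
      using F subspace_sum[OF sub, of "F n" "\<lambda>b. c b *s b"] in_W unfolding s_def by blast
    have xs: "x b (s n) = (if b \<in> F n then c b else 0)" if b: "b \<in> B" for b n
      unfolding s_def by (rule coords_dual_sum[OF x sub BW dual b F])
    have close: "\<parallel>s m - s n\<parallel> \<le> 1 / real (Suc N)" if "N \<le> m" "N \<le> n" for m n N
    proof (cases "s m - s n = 0")
      case False
      then obtain b where b: "b \<in> B" "val (x b (s m - s n)) = \<parallel>s m - s n\<parallel>"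
        using nrm s subspace_diff[OF sub] by metis
      have "F N \<subseteq> F m" "F N \<subseteq> F n"
        using that by (auto simp: F_def frac_le elim!: order_trans[rotated])
      have x_diff: "x b (s m - s n) = (if b \<in> F m then c b else 0) - (if b \<in> F n then c b else 0)"
        using coords_diff[OF x sub b(1) s s, of m n] xs[OF b(1)] by simp
      show ?thesis
      proof (cases "b \<in> F N")
        case True
        then have "x b (s m - s n) = 0"
          using \<open>F N \<subseteq> F m\<close> \<open>F N \<subseteq> F n\<close> x_diff by auto
        then show ?thesis using b(2) by simp
      next
        case False
        then have "val (c b) < 1 / real (Suc N)" using b(1) by (simp add: F_def)
        then show ?thesis using x_diff b(2) by (auto split: if_splits)
      qed
    qed simp
    have "Cauchy s"
      unfolding Cauchy_def
    proof (intro allI impI)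
      fix \<epsilon> :: real assume "0 < \<epsilon>"
      then obtain N where "1 / real (Suc N) < \<epsilon>"
        by (rule nat_approx_posE)
      then show "\<exists>M. \<forall>m\<ge>M. \<forall>n\<ge>M. dist (s m) (s n) < \<epsilon>"
        using close unfolding dist_nrm by (meson order_le_less_trans)
    qed
    then obtain v where v: "s \<longlonglongrightarrow> v"
      using Cauchy_convergent_iff convergent_def by blast
    then have vW: "v \<in> W"
      using closed_sequentially[of W s v] s W' by auto
    have "x b v = c b" if b: "b \<in> B" for b
    proof (rule ccontr)
      let ?d = "c b - x b v"
      assume "x b v \<noteq> c b"
      then have pos: "0 < val ?d"
        using val_ge_0[of ?d] val_eq_0_iff[of ?d] by (simp del: val_ge_0)
      obtain N1 where N1: "\<And>n. N1 \<le> n \<Longrightarrow> dist (s n) v < val ?d"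
        using v pos unfolding lim_sequentially by blast
      obtain N2 where N2: "1 / real (Suc N2) < val ?d"
        using pos by (rule nat_approx_posE)
      define n where "n = max N1 N2"
      have "val (x b (s n) - x b v) < val ?d"
        using N1[of n] coords_le[OF x b, of "s n - v"] coords_diff[OF x sub b s vW] subspace_diff[OF sub s vW]
        by (force simp: n_def dist_nrm)
      moreover have "val (c b - x b (s n)) < val ?d"
      proof (cases "b \<in> F n")
        case False
        then have "val (c b) < 1 / real (Suc n)" using b by (simp add: F_def)
        also have "\<dots> \<le> 1 / real (Suc N2)" by (simp add: n_def frac_le)
        finally show ?thesis using N2 False xs[OF b] by simp
      qed (use pos xs[OF b] in simp)
      ultimately show False
        using val_add_le_max[of "c b - x b (s n)" "x b (s n) - x b v"] by simp
    qed
    then show ?thesis using vW by blast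
  qed
  show ?thesis
    unfolding orthonormal_schauder_basis_def
  proof (intro conjI ballI)
    show "B \<subseteq> W" by (rule BW)
    show "\<parallel>e\<parallel> = 1" if "e \<in> B" for e
      using ortho_modD1[OF B that] .
  next
    fix c :: "'v \<Rightarrow> 'k" assume "c \<in> C0 B"
    then obtain v where v: "v \<in> W" "\<And>b. b \<in> B \<Longrightarrow> x b v = c b"
      using ex by blast
    have sum: "((\<lambda>b. c b *s b) has_sum v) B"
      using onb_has_sum[OF W x dual v(1)] v(2) by (subst has_sum_cong[of _ _ "\<lambda>b. x b v *s b"]) auto
    then show "(\<lambda>b. c b *s b) summable_on B"
      by (rule has_sum_imp_summable)
    have "\<parallel>v\<parallel> = C0_norm B c"
    proof (cases "B = {}")
      case True
      then show ?thesis using nrm v(1) by (cases "v = 0") (auto simp: C0_norm_def)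
    next
      case False
      have "(SUP b\<in>B. val (c b)) = \<parallel>v\<parallel>"
      proof (cases "v = 0")
        case True
        then have "val (c b) = 0" if "b \<in> B" for b
          using v(2)[OF that] coords_le[OF x that v(1)] True val_ge_0[of "c b"] by (simp del: val_ge_0)
        then show ?thesis using True False by simp
      next
        case nz: False
        then obtain b where "b \<in> B" "val (x b v) = \<parallel>v\<parallel>"
          using nrm v(1) by blast
        then show ?thesis
          using v(2) coords_le[OF x _ v(1)] by (intro cSup_eq_maximum) (auto intro!: image_eqI[of _ _ b])
      qed
      then show ?thesis using False by (simp add: C0_norm_def)
    qed
    then show "\<parallel>\<Sum>\<^sub>\<infinity>b\<in>B. c b *s b\<parallel> = C0_norm B c"
      using infsumI[OF sum] by simp
  next
    fix v assume v: "v \<in> W"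
    have "(\<lambda>b. x b v) \<in> C0 B"
      using coords_finite[OF x v] by (simp add: C0_def)
    then show "\<exists>c\<in>C0 B. ((\<lambda>e. c e *s e) has_sum v) B"
      using onb_has_sum[OF W x _ v] dual by (intro bexI[of _ "\<lambda>b. x b v"]) auto
  qed
qed

lemma orthonormal_schauder_basis_imp_onb:
  assumes E: "orthonormal_schauder_basis W E" and W: "subspace W" "closed W"
  shows "onb W E"
proof -
  have "orthonormal E"
    unfolding ortho_mod_def
  proof (intro conjI ballI allI impI)
    show "\<parallel>e\<parallel> = 1" if "e \<in> E" for e
      using E that by (simp add: orthonormal_schauder_basis_def)
  next
    fix F and c :: "'v \<Rightarrow> 'k" and w e
    assume "finite F \<and> F \<subseteq> E \<and> w \<in> {0::'v} \<and> e \<in> F"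
    then have F: "finite F" "F \<subseteq> E" and w: "w = 0" and e: "e \<in> F" by auto
    \<comment> \<open>Extension by zero puts the finite family into \<open>C0 E\<close>, and its
      infinite sum is the finite one.\<close>
    define d where "d a = (if a \<in> F then c a else 0)" for a
    have "{a \<in> E. \<epsilon> \<le> val (d a)} \<subseteq> F" if "0 < \<epsilon>" for \<epsilon>
      using that by (auto simp: d_def)
    then have "d \<in> C0 E"
      using finite_subset[OF _ F(1)] by (simp add: C0_def)
    then have "\<parallel>\<Sum>\<^sub>\<infinity>e\<in>E. d e *s e\<parallel> = C0_norm E d"
      using E by (simp add: orthonormal_schauder_basis_def)
    moreover have "(\<Sum>\<^sub>\<infinity>e\<in>E. d e *s e) = (\<Sum>\<^sub>\<infinity>e\<in>F. d e *s e)"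
      by (rule infsum_cong_neutral) (use F in \<open>auto simp: d_def\<close>)
    ultimately have *: "\<parallel>\<Sum>e\<in>F. c e *s e\<parallel> = C0_norm E d"
      using F(1) by (simp add: d_def)
    have "finite (val ` d ` E)"
      by (rule finite_subset[of _ "insert 0 (val ` c ` F)"]) (use F in \<open>auto simp: d_def\<close>)
    then have "val (d e) \<le> (SUP e\<in>E. val (d e))"
      using F(2) e by (intro cSUP_upper bdd_above_finite) (auto simp: image_image)
    then show "val (c e) \<le> \<parallel>(\<Sum>a\<in>F. c a *s a) + w\<parallel>"
      using * e F(2) by (auto simp: d_def w C0_norm_def)
  qed
  moreover have "closed_span E \<subseteq> W"
    using E W by (intro closed_span_minimal) (auto simp: orthonormal_schauder_basis_def)
  moreover have "W \<subseteq> closed_span E"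
  proof
    fix v assume "v \<in> W"
    then obtain c :: "'v \<Rightarrow> 'k" where "((\<lambda>e. c e *s e) has_sum v) E"
      using E unfolding orthonormal_schauder_basis_def by blast
    then have lim: "(sum (\<lambda>e. c e *s e) \<longlongrightarrow> v) (finite_subsets_at_top E)"
      by (simp add: has_sum_def)
    have "(\<Sum>e\<in>F. c e *s e) \<in> closed_span E" if "F \<subseteq> E" for F
      using that closed_span_superset by (intro subspace_sum subspace_scale) auto
    then have "\<forall>\<^sub>F F in finite_subsets_at_top E. (\<Sum>e\<in>F. c e *s e) \<in> closed_span E"
      unfolding eventually_finite_subsets_at_top by (intro exI[of _ "{}"]) auto
    then show "v \<in> closed_span E"
      by (rule Lim_in_closed_set[OF closed_closed_span _ finite_subsets_at_top_neq_bot lim])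
  qed
  ultimately show ?thesis by (simp add: onb_def)
qed

lemma free_subspace_iff: "subspace W \<Longrightarrow> closed W \<Longrightarrow> free_subspace W \<longleftrightarrow> (\<exists>B. onb W B)"
  unfolding free_subspace_def
  using onb_imp_orthonormal_schauder_basis orthonormal_schauder_basis_imp_onb by blast

text \<open>\<open>U\<close> need not contain any vector of a basis of \<open>W\<close>, but the
  coordinates on \<open>W\<close> restrict to \<open>U\<close>, where Gruson's theorem starts from
  the empty partial basis.\<close>

lemma free_subspace_closed_subspace:
  assumes "free_subspace W" "subspace W" "closed W" "subspace U" "closed U" "U \<subseteq> W"
  shows "free_subspace U"
proof -
  obtain B where "onb W B"
    using assms free_subspace_iff by blast
  then obtain x where "coords W {} B x"
    using onb_coords by metis
  then have "coords U {} B x"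
    using assms(6) coords_mono by blast
  then obtain B' where "onb U B'"
    using onb_extension[OF assms(4,5)] orthonormal_empty by blast
  then show ?thesis
    using free_subspace_iff assms by blast
qed

end

section \<open>Ultrafilters and regular rank\<close>

lemma complete_filter_countable:
  assumes U: "complete_filter \<mu> U" and \<mu>: "natLeq <o \<mu>" and P: "\<And>n :: nat. \<forall>\<^sub>F x in U. P n x"
  shows "\<forall>\<^sub>F x in U. \<forall>n. P n x"
proof -
  have "|range (\<lambda>n. {x. P n x})| \<le>o |UNIV :: nat set|"
    by (rule card_of_image)
  also have "|UNIV :: nat set| =o natLeq"
    by (rule card_of_nat)
  finally have "|range (\<lambda>n. {x. P n x})| <o \<mu>"
    using \<mu> ordLeq_ordLess_trans by blast
  then have "\<forall>\<^sub>F x in U. x \<in> \<Inter>(range (\<lambda>n. {x. P n x}))"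
    using U[unfolded complete_filter_def, rule_format, of "range (\<lambda>n. {x. P n x})"] P by simp
  then show ?thesis by simp
qed

text \<open>If no fibre belonged to \<open>U\<close>, the complements of all fibres would; there are
  fewer than \<open>\<mu>\<close> of them, and no point of \<open>X\<close> lies in all.\<close>

lemma ultrafilter_eventually_const:
  assumes U: "ultrafilter_on X U" "complete_filter \<mu> U" and A: "|A| <o \<mu>" and f: "\<And>x. x \<in> X \<Longrightarrow> f x \<in> A"
  shows "\<exists>a\<in>A. \<forall>\<^sub>F x in U. f x = a"
proof (rule ccontr)
  assume none: "\<not> ?thesis"
  have bot: "U \<noteq> bot" and UX: "\<forall>\<^sub>F x in U. x \<in> X"
    using U(1) by (auto simp: ultrafilter_on_def proper_filter_on_def le_principal)
  let ?\<A> = "(\<lambda>a. X - {x \<in> X. f x = a}) ` A"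
  have mem: "\<forall>\<^sub>F x in U. x \<in> X - {x \<in> X. f x = a}" if "a \<in> A" for a
  proof -
    have "(\<forall>\<^sub>F x in U. x \<in> {x \<in> X. f x = a}) \<or> (\<forall>\<^sub>F x in U. x \<in> X - {x \<in> X. f x = a})"
      using conjunct2[OF U(1)[unfolded ultrafilter_on_def], rule_format, of "{x \<in> X. f x = a}"] by simp
    moreover have "\<not> (\<forall>\<^sub>F x in U. x \<in> {x \<in> X. f x = a})"
      using none that eventually_mono[of "\<lambda>x. x \<in> {x \<in> X. f x = a}" U "\<lambda>x. f x = a"] by blast
    ultimately show ?thesis by blast
  qed
  obtain x where "x \<in> X"
    using eventually_happens'[OF bot UX] by blast
  then have "?\<A> \<noteq> {}"
    using f by blast
  moreover have "|?\<A>| <o \<mu>"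
    using card_of_image A ordLeq_ordLess_trans by blast
  moreover have "\<forall>Y\<in>?\<A>. \<forall>\<^sub>F x in U. x \<in> Y"
    using mem by blast
  ultimately have "\<forall>\<^sub>F x in U. x \<in> \<Inter>?\<A>"
    using U(2)[unfolded complete_filter_def, rule_format, of ?\<A>] by blast
  then have "\<forall>\<^sub>F x in U. x \<in> \<Inter>?\<A> \<and> x \<in> X"
    using UX by (rule eventually_conj)
  then obtain x where "x \<in> \<Inter>?\<A>" "x \<in> X"
    using eventually_happens'[OF bot] by blast
  then show False using f by blast
qed

lemma quotient_by_valuation_ring_less_lambda_field:
  "|quotient_by_valuation_ring TYPE('k :: complete_valuation_field)| <o lambda_field TYPE('k)"
proof -
  let ?q = "|quotient_by_valuation_ring TYPE('k)|"
  have "?q \<le>o card_max ?q natLeq"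
  proof (cases "?q \<le>o natLeq")
    case True
    then show ?thesis
      using card_max_absorb2[OF card_of_Card_order natLeq_Card_order True] ordIso_iff_ordLeq ordLeq_transitive
      by blast
  next
    case False
    then have "natLeq \<le>o ?q"
      using ordLeq_total[OF card_of_Well_order natLeq_Well_order] by blast
    then show ?thesis
      using card_max_absorb1[OF card_of_Card_order natLeq_Card_order] ordIso_iff_ordLeq by blast
  qed
  then show ?thesis
    unfolding lambda_field_def using cardSuc_greater[OF Card_order_card_max] ordLeq_ordLess_trans by blast
qed

text \<open>
  A \<open>\<lambda>\<^sub>k\<close>-complete ultrafilter determines the class of \<open>f\<close> modulo each of the countably many
  balls \<open>\<pi>\<^sup>n O\<^sub>k\<close>, since each quotient is in bijection with \<open>k / O\<^sub>k\<close>.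
\<close>

lemma ultrafilter_eventually_const_field:
  fixes f :: "'a \<Rightarrow> 'k :: complete_valuation_field"
  assumes U: "ultrafilter_on X U" "complete_filter (lambda_field TYPE('k)) U"
    and \<pi>: "0 < val (\<pi> :: 'k)" "val \<pi> < 1"
  shows "\<exists>c. \<forall>\<^sub>F x in U. f x = c"
proof -
  let ?R = "{(x, y). x - y \<in> (valuation_ring :: 'k set)}"
  define q where "q n x = ?R `` {f x / \<pi> ^ n}" for n x
  have bot: "U \<noteq> bot"
    using U(1) by (simp add: ultrafilter_on_def proper_filter_on_def)
  have "q n x \<in> quotient_by_valuation_ring TYPE('k)" for n x
    unfolding q_def quotient_by_valuation_ring_def by (rule quotientI) simp
  then have "\<exists>a. \<forall>\<^sub>F x in U. q n x = a" for n
    using ultrafilter_eventually_const[OF U quotient_by_valuation_ring_less_lambda_field, of "q n"] by blast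
  then obtain a where "\<And>n. \<forall>\<^sub>F x in U. q n x = a n"
    by metis
  then have ev: "\<forall>\<^sub>F x in U. \<forall>n. q n x = a n"
    by (rule complete_filter_countable[OF U(2) lambda_field_uncountable(2)])
  then obtain x0 where x0: "\<forall>n. q n x0 = a n"
    using eventually_happens'[OF bot] by blast
  have "f x = f x0" if x: "\<forall>n. q n x = a n" for x
  proof (rule ccontr)
    assume "f x \<noteq> f x0"
    then have pos: "0 < val (f x - f x0)"
      using val_ge_0[of "f x - f x0"] val_eq_0_iff[of "f x - f x0"] by (simp del: val_ge_0)
    obtain n where n: "val \<pi> ^ n < val (f x - f x0)"
      using real_arch_pow_inv[OF pos \<pi>(2)] by blast
    have "f x0 / \<pi> ^ n \<in> ?R `` {f x0 / \<pi> ^ n}"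
      by (simp add: valuation_ring_def)
    also have "\<dots> = ?R `` {f x / \<pi> ^ n}"
      using x x0 by (simp add: q_def)
    finally have "val (f x / \<pi> ^ n - f x0 / \<pi> ^ n) \<le> 1"
      by (simp add: valuation_ring_def)
    then have "val (f x - f x0) / val \<pi> ^ n \<le> 1"
      by (simp add: val_divide val_power flip: diff_divide_distrib)
    then have "val (f x - f x0) \<le> val \<pi> ^ n"
      using \<pi>(1) by (simp add: divide_le_eq)
    then show False using n by simp
  qed
  then show ?thesis
    using ev by (intro exI[of _ "f x0"]) (auto elim!: eventually_mono)
qed

section \<open>The filter of tails of a regular cardinal\<close>

lemma regularCard_bounded:
  assumes r: "Card_order r" "regularCard r" and K: "K \<subseteq> Field r" "|K| <o r"
  shows "\<exists>a\<in>Field r. \<forall>b\<in>K. (b, a) \<in> r"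
proof -
  have "\<not> |K| =o r"
    using K(2) not_ordLess_ordIso by blast
  then have "\<not> cofinal K r"
    using r(2) K(1) unfolding regularCard_def by blast
  then obtain a where a: "a \<in> Field r" "\<forall>b\<in>K. \<not> (a \<noteq> b \<and> (a, b) \<in> r)"
    unfolding cofinal_def by blast
  have wo: "wo_rel r"
    using r(1) by (simp add: wo_rel_def card_order_on_well_order_on)
  then have "(b, a) \<in> r" if "b \<in> K" for b
    using a that K(1) wo_rel.TOTALS[OF wo] by (metis subsetD)
  then show ?thesis using a(1) by blast
qed

lemma underS_trans:
  assumes "Card_order r" "(a, b) \<in> r" "b \<in> underS r c"
  shows "a \<in> underS r c"
proof -
  have wo: "wo_rel r"
    using assms(1) by (simp add: wo_rel_def card_order_on_well_order_on)
  then show ?thesis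
    using assms(2,3) wo_rel.TRANS[OF wo] wo_rel.ANTISYM[OF wo] unfolding underS_def
    by (auto dest: transD antisymD)
qed

text \<open>By regularity, fewer than \<open>r\<close> tails contain a common one, which gives
  completeness; the filter is proper because an infinite cardinal has no last element. The tails are
  strict to match the initial segments \<open>underS\<close> that generate the subspaces.\<close>

lemma regular_tail_filter:
  assumes r: "Card_order r" "\<not> finite (Field r)" "regularCard r"
  obtains F where "proper_filter_on (Field r) F" "complete_filter r F"
    "\<And>a. a \<in> Field r \<Longrightarrow> \<forall>\<^sub>F b in F. a \<in> underS r b"
proof -
  define F where "F = (INF a\<in>Field r. principal {b. a \<in> underS r b})"
  have ne: "Field r \<noteq> {}" using r(2) by auto
  have wo: "wo_rel r"
    using r(1) by (simp add: wo_rel_def card_order_on_well_order_on)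
  have ev: "eventually P F \<longleftrightarrow> (\<exists>a\<in>Field r. \<forall>b. a \<in> underS r b \<longrightarrow> P b)" for P
    unfolding F_def
  proof (subst eventually_INF_base[OF ne])
    fix a b assume ab: "a \<in> Field r" "b \<in> Field r"
    then have "(a, b) \<in> r \<or> (b, a) \<in> r"
      using wo_rel.TOTALS[OF wo] by blast
    then obtain c where "c \<in> Field r" "(a, c) \<in> r" "(b, c) \<in> r"
      using ab wo_rel.REFL[OF wo] unfolding refl_on_def by blast
    then show "\<exists>c\<in>Field r. principal {x. c \<in> underS r x} \<le> inf (principal {x. a \<in> underS r x}) (principal {x. b \<in> underS r x})"
      using underS_trans[OF r(1)] by (intro bexI[of _ c]) (auto simp: inf_principal)
  qed (simp add: eventually_principal)
  show ?thesis
  proof (rule that[of F])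
    have "F \<noteq> bot"
    proof
      assume "F = bot"
      then have "eventually (\<lambda>_. False) F" by simp
      then obtain a where "a \<in> Field r" "\<forall>b. a \<notin> underS r b"
        unfolding ev by blast
      then show False
        using infinite_Card_order_limit[OF r(1,2)] by (auto simp: underS_def)
    qed
    moreover have "F \<le> principal (Field r)"
      unfolding le_principal ev using ne by (auto simp: underS_def Field_def)
    ultimately show "proper_filter_on (Field r) F"
      by (simp add: proper_filter_on_def)
  next
    show "complete_filter r F"
      unfolding complete_filter_def
    proof (intro allI impI)
      fix \<A> assume \<A>: "\<A> \<noteq> {} \<and> |\<A>| <o r \<and> (\<forall>A\<in>\<A>. \<forall>\<^sub>F x in F. x \<in> A)"
      then have "\<forall>A\<in>\<A>. \<exists>a\<in>Field r. \<forall>b. a \<in> underS r b \<longrightarrow> b \<in> A"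
        unfolding ev by blast
      then obtain a where a: "\<And>A. A \<in> \<A> \<Longrightarrow> a A \<in> Field r" "\<And>A b. A \<in> \<A> \<Longrightarrow> a A \<in> underS r b \<Longrightarrow> b \<in> A"
        by metis
      have "|a ` \<A>| <o r"
        using \<A> card_of_image ordLeq_ordLess_trans by blast
      then obtain c where c: "c \<in> Field r" "\<And>A. A \<in> \<A> \<Longrightarrow> (a A, c) \<in> r"
        using regularCard_bounded[OF r(1,3), of "a ` \<A>"] a(1) by blast
      then show "\<forall>\<^sub>F x in F. x \<in> \<Inter>\<A>"
        unfolding ev using a(2) underS_trans[OF r(1)] by (intro bexI[of _ c]) blast+
    qed
  next
    show "\<forall>\<^sub>F b in F. a \<in> underS r b" if "a \<in> Field r" for a
      unfolding ev using that by blast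
  qed
qed

context banach_vector_space
begin

lemma free_iff: "free \<longleftrightarrow> (\<exists>B. onb UNIV B)"
  unfolding free_def by (rule free_subspace_iff) simp_all

lemma cardinal_freeD:
  assumes "cardinal_free \<kappa>" "|S| <o \<kappa>"
  shows "\<exists>B. onb (closed_span S) B"
  using assms free_subspace_iff[of "closed_span S"] unfolding cardinal_free_def by simp

text \<open>By freeness of its closed span, the norm of a vector is the value of a scalar, hence 0
  or 1. Orthonormality then only asks that nontrivial combinations be nonzero.\<close>

lemma trivially_valued_free:
  assumes triv: "\<And>c :: 'k. c \<noteq> 0 \<Longrightarrow> val c = 1" and free: "\<And>v. \<exists>B. onb (closed_span {v}) B"
  shows "\<exists>B. onb UNIV B"
proof -
  have nrm: "\<parallel>v\<parallel> = 1" if v: "v \<noteq> 0" for v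
  proof -
    obtain B where "onb (closed_span {v}) B" using free by blast
    moreover have "v \<in> closed_span {v}" using closed_span_superset by blast
    ultimately obtain c :: 'k where "val c = \<parallel>v\<parallel>"
      using onb_coords v by blast
    moreover have "\<parallel>v\<parallel> \<noteq> 0" using v by (simp add: nrm_eq_0_iff)
    ultimately show ?thesis using triv[of c] by (cases "c = 0") auto
  qed
  define B where "B = extend_basis {}"
  have ind: "independent B"
    unfolding B_def by (rule independent_extend_basis[OF independent_empty])
  have "orthonormal B"
    unfolding ortho_mod_def
  proof (intro conjI allI impI ballI)
    show "\<parallel>e\<parallel> = 1" if "e \<in> B" for e
      using nrm that ind dependent_zero by metis
  next
    fix F and c :: "'v \<Rightarrow> 'k" and w e
    assume "finite F \<and> F \<subseteq> B \<and> w \<in> {0::'v} \<and> e \<in> F"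
    then have F: "finite F" "F \<subseteq> B" "e \<in> F" and w: "w = 0" by auto
    show "val (c e) \<le> \<parallel>(\<Sum>a\<in>F. c a *s a) + w\<parallel>"
    proof (cases "c e = 0")
      case False
      then have "(\<Sum>a\<in>F. c a *s a) \<noteq> 0"
        using ind F unfolding dependent_explicit by blast
      then show ?thesis using triv[OF False] nrm w by simp
    qed (simp add: nrm_ge_0)
  qed
  moreover have "closed_span B = UNIV"
    using span_subset_closed_span[of B] span_extend_basis[OF independent_empty] unfolding B_def by blast
  ultimately show ?thesis by (auto simp: onb_def)
qed

text \<open>
  The coordinates on the whole space are the limits along \<open>U\<close> of coordinates on the subspaces \<open>W a\<close>;
  this is the ultraproduct of the bases, where a class of sections is represented by the functional
  that it defines.
\<close>

lemma onb_ultraproduct: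
  assumes U: "ultrafilter_on X U" "complete_filter \<mu> U" "natLeq <o \<mu>"
    and const: "\<And>f :: 'a \<Rightarrow> 'k. \<exists>c. \<forall>\<^sub>F a in U. f a = c"
    and onb: "\<And>a. a \<in> X \<Longrightarrow> \<exists>B. onb (W a) B"
    and W: "\<And>v. \<forall>\<^sub>F a in U. v \<in> W a"
  shows "\<exists>B. onb UNIV B"
proof -
  have bot: "U \<noteq> bot" and UX: "\<forall>\<^sub>F a in U. a \<in> X"
    using U(1) by (auto simp: ultrafilter_on_def proper_filter_on_def le_principal)
  have "\<forall>a\<in>X. \<exists>(B :: 'v set) x. coords (W a) {} B x \<and> (\<forall>v\<in>W a. v \<noteq> 0 \<longrightarrow> (\<exists>b\<in>B. val (x b v) = \<parallel>v\<parallel>))"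
  proof
    fix a assume "a \<in> X"
    then obtain B where B: "onb (W a) B" using onb by blast
    have "\<exists>x. coords (W a) {} B x \<and> (\<forall>v\<in>W a. v \<noteq> 0 \<longrightarrow> (\<exists>b\<in>B. val (x b v) = \<parallel>v\<parallel>))"
      using onb_coords[OF B] by (elim exE conjE) (intro exI conjI)
    then show "\<exists>(B :: 'v set) x. coords (W a) {} B x \<and> (\<forall>v\<in>W a. v \<noteq> 0 \<longrightarrow> (\<exists>b\<in>B. val (x b v) = \<parallel>v\<parallel>))"
      by (rule exI)
  qed
  from bchoice[OF this] obtain B :: "'a \<Rightarrow> 'v set" where
    "\<forall>a\<in>X. \<exists>x. coords (W a) {} (B a) x \<and> (\<forall>v\<in>W a. v \<noteq> 0 \<longrightarrow> (\<exists>b\<in>B a. val (x b v) = \<parallel>v\<parallel>))" ..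
  from bchoice[OF this] obtain x where
    *: "\<forall>a\<in>X. coords (W a) {} (B a) (x a) \<and> (\<forall>v\<in>W a. v \<noteq> 0 \<longrightarrow> (\<exists>b\<in>B a. val (x a b v) = \<parallel>v\<parallel>))" ..
  have x: "coords (W a) {} (B a) (x a)" if "a \<in> X" for a
    using * that by blast
  have nrm: "\<exists>b\<in>B a. val (x a b v) = \<parallel>v\<parallel>" if "a \<in> X" "v \<in> W a" "v \<noteq> 0" for a v
    using * that by blast
  define lim where "lim e \<phi> \<longleftrightarrow> (\<forall>\<^sub>F a in U. e a \<in> B a) \<and> (\<forall>v. \<forall>\<^sub>F a in U. x a (e a) v = \<phi> v)" for e \<phi>
  define \<Phi> where "\<Phi> = {\<phi>. \<exists>e. lim e \<phi>}"
  have lim_ex: "\<exists>\<phi>. lim e \<phi>" if "\<forall>\<^sub>F a in U. e a \<in> B a" for e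
    using that const[of "\<lambda>a. x a (e a) _"] unfolding lim_def by metis
  \<comment> \<open>Transfer in the manner of Los: on finitely many vectors, a limit functional
    agrees with a coordinate of a single \<open>W a\<close>.\<close>
  have \<Phi>_fact: "P \<phi>" if \<phi>: "\<phi> \<in> \<Phi>" and S: "finite S"
    and P: "\<And>a b. coords (W a) {} (B a) (x a) \<Longrightarrow> b \<in> B a \<Longrightarrow> S \<subseteq> W a \<Longrightarrow> \<forall>v\<in>S. x a b v = \<phi> v \<Longrightarrow> P \<phi>"
    for \<phi> S P
  proof -
    obtain e where e: "lim e \<phi>" using \<phi> by (auto simp: \<Phi>_def)
    have "\<forall>\<^sub>F a in U. \<forall>v\<in>S. v \<in> W a"
      using S W by (simp add: eventually_ball_finite_distrib)
    moreover have "\<forall>\<^sub>F a in U. \<forall>v\<in>S. x a (e a) v = \<phi> v"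
      using S e by (simp add: eventually_ball_finite_distrib lim_def)
    moreover have "\<forall>\<^sub>F a in U. e a \<in> B a"
      using e by (simp add: lim_def)
    ultimately have "\<forall>\<^sub>F a in U. P \<phi>"
      using UX by eventually_elim (rule P[OF x], auto)
    then show ?thesis
      using eventually_happens'[OF bot] by blast
  qed
  have "coords UNIV {} \<Phi> (\<lambda>\<phi>. \<phi>)"
    unfolding coords_def
  proof (intro conjI ballI allI impI)
    fix \<phi> u v assume "\<phi> \<in> \<Phi>"
    then show "\<phi> (u + v) = \<phi> u + \<phi> v"
    proof (rule \<Phi>_fact[of _ "{u, v, u + v}"])
      fix a b assume "coords (W a) {} (B a) (x a)" "b \<in> B a" "{u, v, u + v} \<subseteq> W a"
        "\<forall>w\<in>{u, v, u + v}. x a b w = \<phi> w"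
      then show "\<phi> (u + v) = \<phi> u + \<phi> v"
        using coords_add[of "W a" "{}" "B a" "x a" b u v] by auto
    qed simp
  next
    fix \<phi> u c assume "\<phi> \<in> \<Phi>"
    then show "\<phi> (c *s u) = c * \<phi> u"
    proof (rule \<Phi>_fact[of _ "{u, c *s u}"])
      fix a b assume "coords (W a) {} (B a) (x a)" "b \<in> B a" "{u, c *s u} \<subseteq> W a"
        "\<forall>w\<in>{u, c *s u}. x a b w = \<phi> w"
      then show "\<phi> (c *s u) = c * \<phi> u"
        using coords_scale[of "W a" "{}" "B a" "x a" b u c] by auto
    qed simp
  next
    fix \<phi> u assume "\<phi> \<in> \<Phi>"
    then show "val (\<phi> u) \<le> \<parallel>u\<parallel>"
    proof (rule \<Phi>_fact[of _ "{u}"])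
      fix a b assume "coords (W a) {} (B a) (x a)" "b \<in> B a" "{u} \<subseteq> W a" "\<forall>w\<in>{u}. x a b w = \<phi> w"
      then show "val (\<phi> u) \<le> \<parallel>u\<parallel>"
        using coords_le[of "W a" "{}" "B a" "x a" b u] by simp
    qed simp
  next
    fix u and \<epsilon> :: real assume "0 < \<epsilon>"
    \<comment> \<open>A count with values in the natural numbers, of which there are fewer than
      \<open>\<mu>\<close>, is a constant \<open>m\<close> along \<open>U\<close>. More than
      \<open>m\<close> large limit functionals would give more than \<open>m\<close> distinct basis
      vectors at one index.\<close>
    define N where "N a = card {b \<in> B a. \<epsilon> \<le> val (x a b u)}" for a
    have "|UNIV :: nat set| <o \<mu>"
      using card_of_nat U(3) ordIso_ordLess_trans by blast
    then obtain m where m: "\<forall>\<^sub>F a in U. N a = m"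
      using ultrafilter_eventually_const[OF U(1,2), of UNIV N] by auto
    show "finite {\<phi> \<in> \<Phi>. \<epsilon> \<le> val (\<phi> u)}"
    proof (rule ccontr)
      assume "infinite {\<phi> \<in> \<Phi>. \<epsilon> \<le> val (\<phi> u)}"
      then obtain \<Psi> where \<Psi>: "\<Psi> \<subseteq> {\<phi> \<in> \<Phi>. \<epsilon> \<le> val (\<phi> u)}" "finite \<Psi>" "card \<Psi> = Suc m"
        using infinite_arbitrarily_large[of "{\<phi> \<in> \<Phi>. \<epsilon> \<le> val (\<phi> u)}" "Suc m"] by blast
      then have "\<forall>\<psi>\<in>\<Psi>. \<exists>e. lim e \<psi>"
        by (auto simp: \<Phi>_def)
      then obtain e where e: "\<And>\<psi>. \<psi> \<in> \<Psi> \<Longrightarrow> lim (e \<psi>) \<psi>"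
        by metis
      have 1: "\<forall>\<^sub>F a in U. \<forall>\<psi>\<in>\<Psi>. e \<psi> a \<in> B a \<and> x a (e \<psi> a) u = \<psi> u"
        using \<Psi>(2) e by (simp add: eventually_ball_finite_distrib eventually_conj_iff lim_def)
      have "\<forall>\<^sub>F a in U. \<psi> \<noteq> \<psi>' \<longrightarrow> e \<psi> a \<noteq> e \<psi>' a" if "\<psi> \<in> \<Psi>" "\<psi>' \<in> \<Psi>" for \<psi> \<psi>'
      proof (cases "\<psi> = \<psi>'")
        case False
        then obtain v where v: "\<psi> v \<noteq> \<psi>' v" by auto
        have "\<forall>\<^sub>F a in U. x a (e \<psi> a) v = \<psi> v" "\<forall>\<^sub>F a in U. x a (e \<psi>' a) v = \<psi>' v"
          using e that by (auto simp: lim_def)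
        then show ?thesis by eventually_elim (use v in auto)
      qed simp
      then have 2: "\<forall>\<^sub>F a in U. \<forall>\<psi>\<in>\<Psi>. \<forall>\<psi>'\<in>\<Psi>. \<psi> \<noteq> \<psi>' \<longrightarrow> e \<psi> a \<noteq> e \<psi>' a"
        using \<Psi>(2) by (simp add: eventually_ball_finite_distrib)
      have "\<forall>\<^sub>F a in U. u \<in> W a" by (rule W)
      with 1 2 m UX have "\<forall>\<^sub>F a in U. False"
      proof eventually_elim
        case (elim a)
        have "inj_on (\<lambda>\<psi>. e \<psi> a) \<Psi>"
          using elim(2) by (auto simp: inj_on_def)
        moreover have "(\<lambda>\<psi>. e \<psi> a) ` \<Psi> \<subseteq> {b \<in> B a. \<epsilon> \<le> val (x a b u)}"
          using elim(1) \<Psi>(1) by auto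
        moreover have "finite {b \<in> B a. \<epsilon> \<le> val (x a b u)}"
          using coords_finite[OF x[OF elim(4)] elim(5) \<open>0 < \<epsilon>\<close>] .
        ultimately have "card \<Psi> \<le> N a"
          unfolding N_def by (rule card_inj_on_le)
        then show False using elim(3) \<Psi>(3) by simp
      qed
      then show False using bot by simp
    qed
  next
    fix u n assume small: "\<forall>\<phi>\<in>\<Phi>. val (\<phi> u) \<le> 1 / real (Suc n)"
    have "\<parallel>u\<parallel> \<le> 1 / real (Suc n)"
    proof (cases "u = 0")
      case False
      \<comment> \<open>A section through basis vectors at which the norm of \<open>u\<close> is
        attained; its limit functional attains the norm as well.\<close>
      define e where "e a = (SOME b. b \<in> B a \<and> val (x a b u) = \<parallel>u\<parallel>)" for a
      have e: "\<forall>\<^sub>F a in U. e a \<in> B a \<and> val (x a (e a) u) = \<parallel>u\<parallel>"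
        using UX W[of u]
      proof eventually_elim
        case (elim a)
        then have "\<exists>b. b \<in> B a \<and> val (x a b u) = \<parallel>u\<parallel>"
          using nrm False by blast
        then show ?case unfolding e_def by (rule someI_ex)
      qed
      then obtain \<phi> where \<phi>: "lim e \<phi>"
        using lim_ex by (force simp: eventually_conj_iff)
      then have "\<forall>\<^sub>F a in U. x a (e a) u = \<phi> u"
        by (simp add: lim_def)
      with e have "\<forall>\<^sub>F a in U. val (\<phi> u) = \<parallel>u\<parallel>"
        by eventually_elim auto
      then have "val (\<phi> u) = \<parallel>u\<parallel>"
        using eventually_happens'[OF bot] by blast
      moreover have "\<phi> \<in> \<Phi>" using \<phi> by (auto simp: \<Phi>_def)
      ultimately show ?thesis using small by metis
    qed simp
    moreover have "0 \<in> closed_span {}"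
      by (simp add: subspace_0)
    ultimately show "\<exists>m\<in>closed_span {}. \<parallel>u - m\<parallel> \<le> 1 / real (Suc n)"
      by (intro bexI[of _ 0]) auto
  qed simp
  then show ?thesis
    using onb_extension[of UNIV "{}" \<Phi> "\<lambda>\<phi>. \<phi>"] by auto
qed

lemma almost_free_regular:
  assumes card: "|UNIV :: 'v set| =o rank" and compact: "strongly_compact (lambda_field TYPE('k)) rank"
    and reg: "regularCard rank" and af: "almost_free" and \<pi>: "0 < val (\<pi> :: 'k)" "val \<pi> < 1"
  shows "\<exists>B. onb UNIV B"
proof -
  let ?X = "Field rank"
  have r: "Card_order rank" by (rule Card_order_rank)
  have "natLeq \<le>o rank"
    using compact ordLess_ordLeq_trans ordLess_imp_ordLeq unfolding strongly_compact_def by blast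
  then have inf: "\<not> finite ?X"
    using r card_of_Field_ordIso infinite_iff_natLeq_ordLeq ordIso_symmetric ordLeq_ordIso_trans by metis
  obtain F where F: "proper_filter_on ?X F" "complete_filter rank F"
    "\<And>a. a \<in> ?X \<Longrightarrow> \<forall>\<^sub>F b in F. a \<in> underS rank b"
    using regular_tail_filter[OF r inf reg] by blast
  then obtain U where U: "ultrafilter_on ?X U" "complete_filter (lambda_field TYPE('k)) U" "U \<le> F"
    using compact unfolding strongly_compact_def by blast
  have "|UNIV :: 'v set| =o |?X|"
    using card r card_of_Field_ordIso ordIso_symmetric ordIso_transitive by metis
  then obtain g where g: "bij_betw g (UNIV :: 'v set) ?X"
    using card_of_ordIso by blast
  \<comment> \<open>As \<open>#V\<close> is the rank, \<open>g\<close> enumerates all vectors along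
    the rank. Each \<open>W a\<close> has fewer than rank many generators, so almost freeness
    applies, and \<open>W a\<close> contains a given vector once \<open>a\<close> is past its
    index.\<close>
  define W where "W a = closed_span {v. g v \<in> underS rank a}" for a
  show ?thesis
  proof (rule onb_ultraproduct[OF U(1,2) lambda_field_uncountable(2)])
    show "\<exists>c. \<forall>\<^sub>F a in U. f a = c" for f :: "'v \<Rightarrow> 'k"
      by (rule ultrafilter_eventually_const_field[OF U(1,2) \<pi>])
  next
    fix a assume "a \<in> ?X"
    then have "|underS rank a| <o rank"
      by (rule card_of_underS[OF r])
    moreover have "|{v. g v \<in> underS rank a}| \<le>o |underS rank a|"
      using g by (intro iffD1[OF card_of_ordLeq] exI[of _ g]) (auto simp: bij_betw_def inj_on_def)
    ultimately have "|{v. g v \<in> underS rank a}| <o rank"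
      using ordLeq_ordLess_trans by blast
    then show "\<exists>B. onb (W a) B"
      unfolding W_def using cardinal_freeD af unfolding almost_free_def by blast
  next
    fix v
    have "g v \<in> ?X" using g by (auto simp: bij_betw_def)
    then have "\<forall>\<^sub>F a in U. g v \<in> underS rank a"
      using filter_leD[OF U(3)] F(3) by metis
    then show "\<forall>\<^sub>F a in U. v \<in> W a"
    proof eventually_elim
      case (elim a)
      then show ?case
        unfolding W_def using closed_span_superset[of "{v. g v \<in> underS rank a}"] by auto
    qed
  qed
qed

end

section \<open>Singular rank\<close>

lemma countable_ordLeq:
  assumes "countable A" "infinite D"
  shows "|A| \<le>o |D|"
proof -
  obtain f :: "'a \<Rightarrow> nat" where "inj_on f A"
    using assms(1) by (auto simp: countable_def)
  then have "|A| \<le>o |UNIV :: nat set|"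
    by (intro iffD1[OF card_of_ordLeq] exI[of _ f]) simp
  also have "|UNIV :: nat set| =o natLeq"
    by (rule card_of_nat)
  also have "natLeq \<le>o |D|"
    using assms(2) infinite_iff_natLeq_ordLeq by blast
  finally show ?thesis .
qed

lemma card_of_UN_ordLeq:
  "infinite D \<Longrightarrow> |I| \<le>o |D| \<Longrightarrow> (\<And>i. i \<in> I \<Longrightarrow> |A i| \<le>o |D| ) \<Longrightarrow> |\<Union>i\<in>I. A i| \<le>o |D|"
  by (rule card_of_UNION_ordLeq_infinite) blast+

lemma card_of_Un_ordLeq:
  assumes "infinite D" "|A| \<le>o |D|" "|B| \<le>o |D|"
  shows "|A \<union> B| \<le>o |D|"
  by (rule card_of_Un_ordLeq_infinite_Field) (use assms in \<open>simp_all add: card_of_card_order_on Field_card_of\<close>)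

lemma well_order_finite_max:
  assumes r: "Card_order r" and K: "finite K" "K \<noteq> {}" "K \<subseteq> Field r"
  shows "\<exists>m\<in>K. \<forall>k\<in>K. (k, m) \<in> r"
  using K
proof (induction K rule: finite_ne_induct)
  have wo: "wo_rel r"
    using r by (simp add: wo_rel_def card_order_on_well_order_on)
  case (singleton k)
  then show ?case using wo_rel.TOTALS[OF wo] by blast
next
  have wo: "wo_rel r"
    using r by (simp add: wo_rel_def card_order_on_well_order_on)
  case (insert k K)
  then obtain m where m: "m \<in> K" "\<forall>k\<in>K. (k, m) \<in> r" by auto
  then have "(k, m) \<in> r \<or> (m, k) \<in> r" "(k, k) \<in> r"
    using insert.prems wo_rel.TOTALS[OF wo] by blast+
  then show ?case
    using m wo_rel.TRANS[OF wo] by (auto dest: transD)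
qed

context banach_vector_space
begin

text \<open>Orthonormality of \<open>B' - B\<close> modulo the closed span of \<open>B\<close>
  concerns only the space \<open>W\<close>, not the basis chosen for it.\<close>

lemma onb_exchange:
  assumes B: "onb W B" and B': "onb W' B'" "B \<subseteq> B'" and C: "onb W C"
  shows "onb W' (C \<union> (B' - B))"
proof -
  have "ortho_mod (closed_span C) (B' - B)"
    using ortho_mod_closed_spanI[of B' B] B B' C by (simp add: onb_def)
  then have "orthonormal (C \<union> (B' - B))"
    using C orthonormal_Un by (simp add: onb_def)
  moreover have "closed_span (C \<union> (B' - B)) = W'"
  proof
    have "C \<subseteq> W'"
      using closed_span_superset[of C] closed_span_mono[OF B'(2)] B B' C by (simp add: onb_def)
    then have "C \<union> (B' - B) \<subseteq> closed_span B'"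
      using B' closed_span_superset[of B'] by (auto simp: onb_def)
    then show "closed_span (C \<union> (B' - B)) \<subseteq> W'"
      using B' closed_span_subsetI unfolding onb_def by metis
    have "B \<subseteq> closed_span (C \<union> (B' - B))"
      using closed_span_superset[of B] closed_span_mono[of C "C \<union> (B' - B)"] B C by (auto simp: onb_def)
    then have "B' \<subseteq> closed_span (C \<union> (B' - B))"
      using closed_span_superset[of "C \<union> (B' - B)"] by auto
    then show "W' \<subseteq> closed_span (C \<union> (B' - B))"
      using B'(1) closed_span_subsetI by (auto simp: onb_def)
  qed
  ultimately show ?thesis by (simp add: onb_def)
qed

text \<open>Each generator needs countably many basis vectors. Those needed by some element of
  \<open>S\<close> span everything, and an orthonormal set has no redundant member.\<close>

lemma onb_card_le:
  assumes B: "onb (closed_span S) B" and D: "infinite D" "|S| \<le>o |D|"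
  shows "|B| \<le>o |D|"
proof -
  have "\<exists>C. C \<subseteq> B \<and> countable C \<and> s \<in> closed_span C" if "s \<in> S" for s
  proof -
    have "s \<in> closed_span B" using closed_span_superset[of S] B that by (auto simp: onb_def)
    then show ?thesis by (rule closed_span_countable_subset) blast
  qed
  then obtain C where C: "\<And>s. s \<in> S \<Longrightarrow> C s \<subseteq> B" "\<And>s. s \<in> S \<Longrightarrow> countable (C s)"
    "\<And>s. s \<in> S \<Longrightarrow> s \<in> closed_span (C s)"
    by metis
  have "S \<subseteq> closed_span (\<Union>s\<in>S. C s)"
  proof
    fix s assume "s \<in> S"
    then have "closed_span (C s) \<subseteq> closed_span (\<Union>s\<in>S. C s)"
      by (intro closed_span_mono) blast
    then show "s \<in> closed_span (\<Union>s\<in>S. C s)"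
      using C(3) \<open>s \<in> S\<close> by blast
  qed
  then have "closed_span S \<subseteq> closed_span (\<Union>s\<in>S. C s)"
    by (rule closed_span_subsetI)
  then have "B \<subseteq> closed_span (\<Union>s\<in>S. C s)"
    using B closed_span_superset[of B] unfolding onb_def by blast
  moreover have "(\<Union>s\<in>S. C s) \<subseteq> B"
    using C(1) by blast
  ultimately have "e \<in> (\<Union>s\<in>S. C s)" if "e \<in> B" for e
    using orthonormal_notin_closed_span[of B "\<Union>s\<in>S. C s" e] B that unfolding onb_def by blast
  then have "|B| \<le>o |\<Union>s\<in>S. C s|"
    by (intro card_of_mono1) blast
  also have "|\<Union>s\<in>S. C s| \<le>o |D|"
    using C(2) by (intro card_of_UN_ordLeq[OF D] countable_ordLeq[OF _ D(1)])
  finally show ?thesis .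
qed

text \<open>By \<open>onb_exchange\<close>, one such pair lets every basis of \<open>W\<close> be
  extended to one of \<open>W'\<close>. This is the analogue of a free quotient for abelian
  groups.\<close>

definition basis_extends :: "'v set \<Rightarrow> 'v set \<Rightarrow> bool" where
  "basis_extends W W' \<longleftrightarrow> (\<exists>B B'. onb W B \<and> B \<subseteq> B' \<and> onb W' B')"

text \<open>\<open>D\<close> merely carries a cardinal. The instance \<open>S' = S\<close> includes
  freeness of \<open>closed_span S\<close> itself.\<close>

definition pure_in :: "'v set \<Rightarrow> 'v set \<Rightarrow> bool" where
  "pure_in D S \<longleftrightarrow> |S| \<le>o |D| \<and>
     (\<forall>S'. S \<subseteq> S' \<and> |S'| \<le>o |D| \<longrightarrow> basis_extends (closed_span S) (closed_span S'))"

text \<open>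
  Otherwise there is a continuous chain of length \<open>|D|\<^sup>+\<close> in which no \<open>closed_span (S a)\<close> has a
  basis that extends to the next member. The union of the chain spans a free space, and a basis of it
  restricts to a basis of \<open>closed_span (S a)\<close> for some limit \<open>a\<close>; by Gruson's theorem that
  restriction extends to the next member.
\<close>

lemma pure_exists:
  assumes D: "infinite D" "cardSuc |D| <o \<kappa>" and free: "cardinal_free \<kappa>" and X: "|X| \<le>o |D|"
  shows "\<exists>S. X \<subseteq> S \<and> pure_in D S"
proof (rule ccontr)
  assume none: "\<not> ?thesis"
  have "\<exists>S'. X \<subseteq> S \<and> |S| \<le>o |D| \<longrightarrow> S \<subseteq> S' \<and> |S'| \<le>o |D| \<and>
      \<not> basis_extends (closed_span S) (closed_span S')" for S
    using none unfolding pure_in_def by blast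
  then obtain f where f: "\<And>S. X \<subseteq> S \<Longrightarrow> |S| \<le>o |D| \<Longrightarrow> S \<subseteq> f S \<and> |f S| \<le>o |D| \<and>
      \<not> basis_extends (closed_span S) (closed_span (f S))"
    by metis
  define r where "r = cardSuc |D|"
  have Card_D: "Card_order |D|" by (rule card_of_Card_order)
  have r: "Card_order r" "infinite (Field r)" "regularCard r"
    using D(1) Card_D infinite_cardSuc_regularCard[OF _ Card_D]
    by (simp_all add: r_def cardSuc_Card_order cardSuc_finite Field_card_of)
  have wo: "wo_rel r"
    using r(1) by (simp add: wo_rel_def card_order_on_well_order_on)
  have less_r: "K <o r \<longleftrightarrow> K \<le>o |D|" if "Card_order K" for K :: "'z rel"
    unfolding r_def by (rule cardSuc_ordLeq_ordLess[OF Card_D that])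
  \<comment> \<open>\<open>f\<close> is applied at every earlier stage, so a limit stage is just the
    union of the earlier ones.\<close>
  define S where "S = wo_rel.worec r (\<lambda>S a. X \<union> (\<Union>b\<in>underS r a. f (S b)))"
  have "wo_rel.adm_wo r (\<lambda>S a. X \<union> (\<Union>b\<in>underS r a. f (S b)))"
    unfolding wo_rel.adm_wo_def[OF wo] by (auto simp: underS_def)
  from wo_rel.worec_fixpoint[OF wo this] have S: "S a = X \<union> (\<Union>b\<in>underS r a. f (S b))" for a
    unfolding S_def by metis
  have S_card: "|S a| \<le>o |D|" if "a \<in> Field r" for a
    using that
  proof (induction a rule: wo_rel.well_order_induct[OF wo])
    case (1 a)
    have "|underS r a| \<le>o |D|"
      using card_of_underS[OF r(1) 1(2)] less_r card_of_Card_order by blast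
    moreover have "|f (S b)| \<le>o |D|" if "b \<in> underS r a" for b
    proof -
      have "|S b| \<le>o |D|"
        using 1(1) that unfolding underS_def by (auto intro: FieldI1)
      then show ?thesis using f[of "S b"] S by blast
    qed
    ultimately show ?case
      using X D(1) unfolding S[of a] by (intro card_of_Un_ordLeq card_of_UN_ordLeq) auto
  qed
  have f_S: "S a \<subseteq> f (S a)" "|f (S a)| \<le>o |D|"
    "\<not> basis_extends (closed_span (S a)) (closed_span (f (S a)))" if "a \<in> Field r" for a
    using f[of "S a"] S[of a] S_card[OF that] by blast+
  have f_S_sub: "f (S a) \<subseteq> S b" if "a \<in> underS r b" for a b
    using that S[of b] by blast
  have chain: "S a \<subseteq> S b" if "(a, b) \<in> r" for a b
    using f_S(1)[of a] f_S_sub[of a b] that by (cases "a = b") (auto simp: underS_def intro: FieldI1)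
  have limit: "\<exists>c\<in>Field r. a \<in> underS r c" if "a \<in> Field r" for a
    using infinite_Card_order_limit[OF r(1,2) that] by (auto simp: underS_def)
  define T where "T = (\<Union>a\<in>Field r. S a)"
  have "|T| \<le>o r"
    unfolding T_def
  proof (rule UNION_Cinfinite_bound)
    show "|Field r| \<le>o r"
      using card_of_Field_ordIso[OF r(1)] ordIso_imp_ordLeq by blast
    show "\<forall>a\<in>Field r. |S a| \<le>o r"
      using S_card cardSuc_ordLeq[OF Card_D] ordLeq_transitive unfolding r_def by blast
    show "Cinfinite r" using r by (simp add: cinfinite_def)
  qed
  then have "|T| <o \<kappa>"
    using D(2) ordLeq_ordLess_trans unfolding r_def by blast
  then obtain B where B: "onb (closed_span T) B"
    using cardinal_freeD[OF free] by blast
  \<comment> \<open>Passing through countable supports from \<open>S a\<close> to \<open>B\<close>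
    and back to generators in \<open>T\<close> yields at most \<open>|D|\<close> generators; these
    fit into one stage because the successor cardinal is regular.\<close>
  have step: "\<exists>b\<in>Field r. a \<in> underS r b \<and> (\<forall>s\<in>S a. \<exists>C\<subseteq>B. C \<subseteq> closed_span (S b) \<and> s \<in> closed_span C)"
    if a: "a \<in> Field r" for a
  proof -
    have "\<exists>C. C \<subseteq> B \<and> countable C \<and> s \<in> closed_span C" if "s \<in> S a" for s
    proof -
      have "s \<in> closed_span B"
        using closed_span_superset[of T] B that a by (auto simp: onb_def T_def)
      then show ?thesis by (rule closed_span_countable_subset) blast
    qed
    then obtain C where C: "\<And>s. s \<in> S a \<Longrightarrow> C s \<subseteq> B \<and> countable (C s) \<and> s \<in> closed_span (C s)"
      by metis
    have "\<exists>K. K \<subseteq> T \<and> countable K \<and> e \<in> closed_span K" if "e \<in> B" for e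
    proof -
      have "e \<in> closed_span T"
        using closed_span_superset[of B] B that by (auto simp: onb_def)
      then show ?thesis by (rule closed_span_countable_subset) blast
    qed
    then obtain K where K: "\<And>e. e \<in> B \<Longrightarrow> K e \<subseteq> T \<and> countable (K e) \<and> e \<in> closed_span (K e)"
      by metis
    have "|\<Union>e\<in>(\<Union>s\<in>S a. C s). K e| \<le>o |D|"
    proof (rule card_of_UN_ordLeq[OF D(1)])
      show "|\<Union>s\<in>S a. C s| \<le>o |D|"
        using C by (intro card_of_UN_ordLeq[OF D(1) S_card[OF a]] countable_ordLeq[OF _ D(1)]) simp
      fix e assume "e \<in> (\<Union>s\<in>S a. C s)"
      then have "e \<in> B" using C by blast
      then show "|K e| \<le>o |D|"
        using K by (intro countable_ordLeq[OF _ D(1)]) simp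
    qed
    moreover have "(\<Union>e\<in>(\<Union>s\<in>S a. C s). K e) \<subseteq> (\<Union>a\<in>Field r. S a)"
      using K C unfolding T_def by blast
    moreover have "relChain r S"
      using chain by (simp add: relChain_def)
    ultimately have "\<exists>i\<in>Field r. (\<Union>e\<in>(\<Union>s\<in>S a. C s). K e) \<subseteq> S i"
      using D(1) unfolding r_def by (intro cardSuc_UNION[OF Card_D]) (simp_all only: Field_card_of not_False_eq_True)
    then obtain i where i: "i \<in> Field r" "(\<Union>e\<in>(\<Union>s\<in>S a. C s). K e) \<subseteq> S i" ..
    obtain m where m: "m \<in> Field r" "(a, m) \<in> r" "(i, m) \<in> r"
      using well_order_finite_max[OF r(1), of "{a, i}"] a i(1) by auto
    obtain b where b: "b \<in> Field r" "m \<in> underS r b"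
      using limit[OF m(1)] by blast
    have ab: "a \<in> underS r b" "(i, b) \<in> r"
      using underS_trans[OF r(1)] m b by (auto simp: underS_def)
    have "\<exists>C\<subseteq>B. C \<subseteq> closed_span (S b) \<and> s \<in> closed_span C" if s: "s \<in> S a" for s
    proof -
      have "e \<in> closed_span (S b)" if "e \<in> C s" for e
      proof -
        have "e \<in> closed_span (K e)" "K e \<subseteq> S b"
          using K C s that i(2) chain[OF ab(2)] by blast+
        then show ?thesis using closed_span_mono by blast
      qed
      then show ?thesis using C[OF s] by (intro exI[of _ "C s"]) blast
    qed
    then show ?thesis using b ab by blast
  qed
  then obtain h where h: "\<And>a. a \<in> Field r \<Longrightarrow> h a \<in> Field r \<and> a \<in> underS r (h a) \<and>
      (\<forall>s\<in>S a. \<exists>C\<subseteq>B. C \<subseteq> closed_span (S (h a)) \<and> s \<in> closed_span C)"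
    by metis
  obtain a0 where a0: "a0 \<in> Field r"
    using r(2) by (metis finite.emptyI all_not_in_conv)
  define a where "a n = (h ^^ n) a0" for n
  have a_Suc: "a (Suc n) = h (a n)" for n
    by (simp add: a_def)
  have a: "a n \<in> Field r" for n
    by (induction n) (use a0 h in \<open>auto simp: a_Suc\<close>, simp add: a_def)
  \<comment> \<open>Its least element \<open>m\<close> is the supremum of the increasing
    \<open>a n\<close>, so \<open>S m\<close> is the union of the \<open>S (a n)\<close>. By
    \<open>step\<close>, the part of \<open>B\<close> inside \<open>closed_span (S m)\<close> spans
    that space.\<close>
  define ub where "ub = {u \<in> Field r. \<forall>n. a n \<in> underS r u}"
  have "|range a| <o r"
    using less_r[OF card_of_Card_order, of "range a"] countable_ordLeq[OF _ D(1), of "range a"] by simp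
  then obtain c where c: "c \<in> Field r" "\<And>n. (a n, c) \<in> r"
    using regularCard_bounded[OF r(1,3), of "range a"] a by blast
  have "a n \<in> underS r c" for n
  proof -
    have "a n \<in> underS r (a (Suc n))"
      using h[OF a[of n]] by (simp add: a_Suc)
    then show ?thesis
      using c(2)[of "Suc n"] underS_incr[OF wo_rel.TRANS[OF wo] wo_rel.ANTISYM[OF wo]] by blast
  qed
  then have ub: "ub \<subseteq> Field r" "ub \<noteq> {}"
    using c(1) by (auto simp: ub_def)
  define m where "m = wo_rel.minim r ub"
  have m: "m \<in> ub"
    unfolding m_def by (rule wo_rel.minim_in[OF wo ub])
  then have mF: "m \<in> Field r" and am: "\<And>n. a n \<in> underS r m"
    by (auto simp: ub_def)
  have S_m: "\<exists>n. s \<in> S (a n)" if s: "s \<in> S m" for s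
  proof -
    consider "s \<in> X" | b where "b \<in> underS r m" "s \<in> f (S b)"
      using subsetD[OF equalityD1[OF S[of m]] s] by blast
    then show ?thesis
    proof cases
      case 1
      then have "s \<in> S (a 0)" by (subst S) blast
      then show ?thesis ..
    next
      case 2
      have bF: "b \<in> Field r"
        using 2(1) by (auto simp: underS_def intro: FieldI1)
      have "(m, b) \<notin> r"
        using 2(1) wo_rel.ANTISYM[OF wo] by (auto simp: underS_def dest: antisymD)
      then have "b \<notin> ub"
        using wo_rel.minim_least[OF wo ub(1)] unfolding m_def by blast
      then obtain n where "a n \<notin> underS r b"
        using bF by (auto simp: ub_def)
      then have "(b, a n) \<in> r"
        using wo_rel.TOTALS[OF wo] bF a[of n] by (auto simp: underS_def)
      then have "b \<in> underS r (a (Suc n))"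
        using underS_trans[OF r(1)] h[OF a[of n]] by (simp add: a_Suc)
      then show ?thesis
        using f_S_sub 2(2) by blast
    qed
  qed
  define B0 where "B0 = B \<inter> closed_span (S m)"
  have "S m \<subseteq> closed_span B0"
  proof
    fix s assume "s \<in> S m"
    then obtain n where "s \<in> S (a n)" using S_m by blast
    then obtain C where C: "C \<subseteq> B" "C \<subseteq> closed_span (S (a (Suc n)))" "s \<in> closed_span C"
      using h[OF a[of n]] by (auto simp: a_Suc)
    have "S (a (Suc n)) \<subseteq> S m"
      using chain am by (auto simp: underS_def)
    then have "C \<subseteq> B0"
      using C closed_span_mono unfolding B0_def by blast
    then show "s \<in> closed_span B0"
      using C(3) closed_span_mono by blast
  qed
  then have "closed_span (S m) = closed_span B0"
    by (intro equalityI closed_span_subsetI) (auto simp: B0_def)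
  moreover have "orthonormal B0"
    using B ortho_mod_mono[of "{0}" B B0] by (auto simp: onb_def B0_def)
  ultimately have B0: "onb (closed_span (S m)) B0"
    by (simp add: onb_def)
  let ?W = "closed_span (f (S m))"
  have "f (S m) \<subseteq> T"
    using limit[OF mF] f_S_sub unfolding T_def by blast
  then have W: "?W \<subseteq> closed_span T"
    by (rule closed_span_mono)
  obtain x where "coords (closed_span T) B0 (B - B0) x"
    using onb_coords_subset[OF B, of B0] by (auto simp: B0_def)
  then have x: "coords ?W B0 (B - B0) x"
    using coords_mono W by blast
  have "B0 \<subseteq> ?W"
    using closed_span_mono[OF f_S(1)[OF mF]] by (auto simp: B0_def)
  then obtain B' where "B0 \<subseteq> B'" "onb ?W B'"
    using onb_extension[OF _ _ _ _ x] B0 by (auto simp: onb_def)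
  then show False
    using f_S(3)[OF mF] B0 unfolding basis_extends_def by blast
qed

text \<open>The family consists of the bases of spaces spanned by pure sets. Purity extends some
  basis of such a space, and \<open>onb_exchange\<close> swaps in the prescribed one.\<close>

lemma extensible_orthonormal_family:
  fixes D :: "'v set"
  assumes D: "infinite D" "cardSuc |D| <o \<kappa>" and free: "cardinal_free \<kappa>"
  shows "\<exists>\<P>. \<P> \<noteq> {} \<and> (\<forall>B\<in>\<P>. orthonormal B \<and> |B| \<le>o |D| ) \<and>
    (\<forall>B\<in>\<P>. \<forall>R. |R| \<le>o |D| \<longrightarrow> (\<exists>B'\<in>\<P>. B \<subseteq> B' \<and> R \<subseteq> closed_span B'))"
proof -
  define \<P> where "\<P> = {B. orthonormal B \<and> |B| \<le>o |D| \<and> (\<exists>S. pure_in D S \<and> closed_span B = closed_span S)}"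
  have "\<P> \<noteq> {}"
  proof -
    obtain S where S: "pure_in D S"
      using pure_exists[OF assms, of "{}"] card_of_empty by blast
    then obtain B where B: "onb (closed_span S) B"
      unfolding pure_in_def basis_extends_def by blast
    then have "|B| \<le>o |D|"
      using onb_card_le[OF B D(1)] S by (simp add: pure_in_def)
    then have "B \<in> \<P>"
      using B S by (auto simp: \<P>_def onb_def)
    then show ?thesis by blast
  qed
  moreover have "\<exists>B'\<in>\<P>. B \<subseteq> B' \<and> R \<subseteq> closed_span B'" if B: "B \<in> \<P>" and R: "|R| \<le>o |D|" for B R
  proof -
    obtain S where S: "pure_in D S" "onb (closed_span S) B"
      using B by (auto simp: \<P>_def onb_def)
    then have "|S \<union> R| \<le>o |D|"
      using D(1) R card_of_Un_ordLeq by (auto simp: pure_in_def)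
    then obtain S' where S': "S \<union> R \<subseteq> S'" "pure_in D S'"
      using pure_exists[OF assms] by blast
    then obtain C C' where C: "onb (closed_span S) C" "C \<subseteq> C'" "onb (closed_span S') C'"
      using S(1) unfolding pure_in_def basis_extends_def by (metis Un_subset_iff)
    define B' where "B' = B \<union> (C' - C)"
    have B': "onb (closed_span S') B'"
      unfolding B'_def by (rule onb_exchange[OF C(1,3,2) S(2)])
    then have "|B'| \<le>o |D|"
      using onb_card_le[OF B' D(1)] S'(2) by (simp add: pure_in_def)
    then have "B' \<in> \<P>"
      using B' S'(2) by (auto simp: \<P>_def onb_def)
    moreover have "R \<subseteq> closed_span B'"
      using B' S'(1) closed_span_superset[of S'] by (auto simp: onb_def)
    ultimately show ?thesis unfolding B'_def by blast
  qed
  ultimately show ?thesis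
    by (intro exI[of _ \<P>]) (auto simp: \<P>_def)
qed

text \<open>By \<open>restrict\<close>, the earlier spaces are spanned by old vectors of
  \<open>E i\<close>, so its new vectors are orthonormal modulo all of them. The new vectors of all
  stages form the basis.\<close>

lemma onb_chain:
  assumes r: "Card_order r" and A: "A \<subseteq> Field r"
    and E: "\<And>i. i \<in> A \<Longrightarrow> orthonormal (E i)"
    and restrict: "\<And>i j b. i \<in> A \<Longrightarrow> j \<in> A \<Longrightarrow> j \<in> underS r i \<Longrightarrow> b \<in> E j \<Longrightarrow> b \<in> closed_span (E i \<inter> closed_span (E j))"
  shows "\<exists>N. onb (closed_span (\<Union>i\<in>A. E i)) N"
proof -
  have wo: "wo_rel r"
    using r by (simp add: wo_rel_def card_order_on_well_order_on)
  define L where "L i = (\<Union>j\<in>A \<inter> underS r i. closed_span (E j))" for i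
  define N where "N = (\<Union>i\<in>A. E i - L i)"
  have below: "closed_span (E j) \<subseteq> closed_span (E i \<inter> L i)" if "i \<in> A" "j \<in> A" "j \<in> underS r i" for i j
  proof (rule closed_span_subsetI)
    have "closed_span (E i \<inter> closed_span (E j)) \<subseteq> closed_span (E i \<inter> L i)"
      using that by (intro closed_span_mono) (auto simp: L_def)
    then show "E j \<subseteq> closed_span (E i \<inter> L i)"
      using restrict[OF that] by blast
  qed
  have mod: "ortho_mod (closed_span (E i \<inter> L i)) (E i - L i)" if "i \<in> A" for i
    using ortho_mod_closed_spanI[OF E[OF that], of "E i \<inter> L i"] by (simp add: Diff_Int)
  have key: "val (c e) \<le> \<parallel>\<Sum>a\<in>F. c a *s a\<parallel>" if "finite F" "F \<subseteq> N" "e \<in> F" for F c e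
    using that
  proof (induction F arbitrary: e rule: finite_psubset_induct)
    case (psubset F)
    have "\<forall>a\<in>F. \<exists>i. i \<in> A \<and> a \<in> E i - L i"
      using psubset.prems by (auto simp: N_def)
    then obtain idx where idx: "\<And>a. a \<in> F \<Longrightarrow> idx a \<in> A \<and> a \<in> E (idx a) - L (idx a)"
      by metis
    have "\<exists>i\<in>idx ` F. \<forall>j\<in>idx ` F. (j, i) \<in> r"
      using psubset idx A by (intro well_order_finite_max[OF r]) auto
    then obtain i where i: "i \<in> idx ` F" "\<And>a. a \<in> F \<Longrightarrow> (idx a, i) \<in> r"
      by blast
    then have iA: "i \<in> A" using idx by auto
    \<comment> \<open>The vectors of largest index \<open>i\<close> are new in \<open>E i\<close>,
      the remaining sum \<open>w\<close> lies in the span of its old vectors, and the induction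
      hypothesis bounds the coefficients in \<open>w\<close>.\<close>
    define F1 where "F1 = {a \<in> F. idx a = i}"
    define F2 where "F2 = {a \<in> F. idx a \<noteq> i}"
    define w where "w = (\<Sum>a\<in>F2. c a *s a)"
    have F: "F = F1 \<union> F2" "F1 \<inter> F2 = {}" "finite F1" "finite F2"
      using psubset.hyps by (auto simp: F1_def F2_def)
    have sum: "(\<Sum>a\<in>F. c a *s a) = (\<Sum>a\<in>F1. c a *s a) + w"
      unfolding w_def F(1) by (rule sum.union_disjoint[OF F(3,4,2)])
    have F1: "F1 \<subseteq> E i - L i"
      using idx by (auto simp: F1_def)
    have "a \<in> closed_span (E i \<inter> L i)" if a: "a \<in> F2" for a
    proof -
      have "idx a \<in> A" "idx a \<in> underS r i" "a \<in> E (idx a)"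
        using a idx i(2) by (auto simp: F2_def underS_def)
      then show ?thesis
        using below[OF iA] closed_span_superset by blast
    qed
    then have w: "w \<in> closed_span (E i \<inter> L i)"
      unfolding w_def by (intro subspace_sum subspace_scale) auto
    show ?case
    proof (cases "e \<in> F1")
      case True
      then show ?thesis
        unfolding sum using ortho_modD2[OF mod[OF iA] F(3) F1 w] by blast
    next
      case False
      then have "e \<in> F2" using F(1) psubset.prems by blast
      moreover have "F2 \<subset> F" using i(1) by (auto simp: F2_def)
      ultimately have "val (c e) \<le> \<parallel>w\<parallel>"
        unfolding w_def using psubset.IH[of F2 e] psubset.prems by blast
      then show ?thesis
        unfolding sum using ortho_mod_nrm_ge[OF mod[OF iA] F(3) F1 w, of c] by linarith
    qed
  qed
  have "orthonormal N"
    unfolding ortho_mod_def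
  proof (intro conjI allI impI ballI)
    show "\<parallel>e\<parallel> = 1" if "e \<in> N" for e
      using that ortho_modD1[OF E] by (auto simp: N_def)
  qed (use key in auto)
  moreover have "E i \<subseteq> closed_span N" if "i \<in> A" for i
    using that
  proof (induction i rule: wo_rel.well_order_induct[OF wo])
    case (1 i)
    show ?case
    proof
      fix e assume e: "e \<in> E i"
      show "e \<in> closed_span N"
      proof (cases "e \<in> L i")
        case True
        then obtain j where j: "j \<in> A" "j \<in> underS r i" "e \<in> closed_span (E j)"
          by (auto simp: L_def)
        then have "E j \<subseteq> closed_span N"
          using 1 by (auto simp: underS_def)
        then show ?thesis
          using j(3) closed_span_subsetI by blast
      next
        case False
        then have "e \<in> N" using e 1(2) by (auto simp: N_def)
        then show ?thesis using closed_span_superset by blast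
      qed
    qed
  qed
  then have "closed_span N = closed_span (\<Union>i\<in>A. E i)"
    using closed_span_superset[of "\<Union>i\<in>A. E i"]
    by (intro equalityI closed_span_subsetI) (auto simp: N_def)
  ultimately show ?thesis by (auto simp: onb_def)
qed

text \<open>
  Singular compactness. The ladders \<open>B n j\<close> are interleaved such that the support of \<open>B n j\<close> with
  respect to \<open>B n i\<close> is captured by \<open>B (Suc n) j\<close>; in the limit, each earlier space is spanned by a
  part of the basis of each later one.
\<close>

lemma almost_free_singular:
  assumes unc: "natLeq <o rank" and sing: "\<not> regularCard rank" and af: "almost_free"
  shows "\<exists>B. onb UNIV B"
proof -
  let ?X = "Field rank"
  have r: "Card_order rank" by (rule Card_order_rank)
  have inf: "infinite ?X"
    using r unc card_of_Field_ordIso infinite_iff_natLeq_ordLeq ordIso_symmetric ordLeq_ordIso_trans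
      ordLess_imp_ordLeq by metis
  have free: "cardinal_free rank"
    using af by (simp add: almost_free_def)
  have wo: "wo_rel rank"
    using r by (simp add: wo_rel_def card_order_on_well_order_on)
  \<comment> \<open>\<open>rank\<close> is literally \<open>|S|\<close> for a generating set
    \<open>S\<close>, so its field consists of vectors and is itself generating.\<close>
  have span_X: "closed_span ?X = UNIV"
    using rank_attained Field_card_of by metis
  obtain K where K: "K \<subseteq> ?X" "cofinal K rank" "\<not> |K| =o rank"
    using sing unfolding regularCard_def by blast
  have "|K| \<le>o rank"
    using card_of_mono1[OF K(1)] card_of_Field_ordIso[OF r] ordLeq_ordIso_trans by blast
  then have K_less: "|K| <o rank"
    using K(3) ordLeq_iff_ordLess_or_ordIso by blast
  \<comment> \<open>Adjoined to the cofinal set \<open>K\<close> to make \<open>A\<close>, and with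
    it every \<open>D j\<close>, infinite.\<close>
  obtain Z where Z: "Z \<subseteq> ?X" "countable Z" "infinite Z"
    using infinite_countable_subset'[OF inf] by blast
  have "|Z| \<le>o natLeq"
    using countable_ordLeq[OF Z(2), of "UNIV :: nat set"] card_of_nat ordLeq_ordIso_trans by blast
  then have "|Z| <o rank"
    using unc ordLeq_ordLess_trans by blast
  define A where "A = K \<union> Z"
  have A: "A \<subseteq> ?X" "infinite A" "|A| <o rank"
    using K Z K_less \<open>|Z| <o rank\<close> inf r card_of_Un_ordLess_infinite_Field by (auto simp: A_def)
  have cofinal: "\<exists>i\<in>A. a \<in> underS rank i" if "a \<in> ?X" for a
    using K(2) that by (auto simp: cofinal_def underS_def A_def)
  \<comment> \<open>The size allotted to ladder \<open>j\<close>: the segment below \<open>j\<close>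
    must be absorbed, and demands from all indices in \<open>A\<close> must be met in each
    round.\<close>
  define D where "D j = underS rank j \<union> A" for j
  have D: "infinite (D j)" "A \<subseteq> D j" for j
    using A(2) by (auto simp: D_def)
  have D_mono: "D l \<subseteq> D j" if "l \<in> underS rank j" for l j
    using that underS_incr[OF wo_rel.TRANS[OF wo] wo_rel.ANTISYM[OF wo], of l j] by (auto simp: D_def underS_def)
  \<comment> \<open>A singular cardinal is not the successor of an infinite one, as such successors
    are regular. This leaves the room that \<open>pure_exists\<close> requires.\<close>
  have "cardSuc |D j| <o rank" if "j \<in> A" for j
  proof -
    have "|D j| <o rank"
      unfolding D_def using inf r A(3) card_of_underS[OF r] that A(1)
      by (intro card_of_Un_ordLess_infinite_Field) auto
    then have "cardSuc |D j| \<le>o rank"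
      by (rule cardSuc_least[OF card_of_Card_order r])
    moreover have "\<not> cardSuc |D j| =o rank"
    proof
      assume iso: "cardSuc |D j| =o rank"
      have "Cinfinite |D j|"
        using D(1) by (simp add: cinfinite_def Field_card_of card_of_card_order_on)
      then have "regularCard rank"
        using regularCard_ordIso[OF iso Cinfinite_cardSuc regularCard_cardSuc] by blast
      with sing show False ..
    qed
    ultimately show ?thesis
      using ordLeq_iff_ordLess_or_ordIso by blast
  qed
  then have "\<forall>j\<in>A. \<exists>\<P>. \<P> \<noteq> {} \<and> (\<forall>B\<in>\<P>. orthonormal B \<and> |B| \<le>o |D j| ) \<and>
    (\<forall>B\<in>\<P>. \<forall>R. |R| \<le>o |D j| \<longrightarrow> (\<exists>B'\<in>\<P>. B \<subseteq> B' \<and> R \<subseteq> closed_span B'))"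
    using extensible_orthonormal_family[OF D(1) _ free] by blast
  from bchoice[OF this] obtain P where
    *: "\<forall>j\<in>A. P j \<noteq> {} \<and> (\<forall>B\<in>P j. orthonormal B \<and> |B| \<le>o |D j| ) \<and>
    (\<forall>B\<in>P j. \<forall>R. |R| \<le>o |D j| \<longrightarrow> (\<exists>B'\<in>P j. B \<subseteq> B' \<and> R \<subseteq> closed_span B'))" ..
  have P_ne: "P j \<noteq> {}" if "j \<in> A" for j
    using * that by blast
  have P: "orthonormal B" "|B| \<le>o |D j|" if "j \<in> A" "B \<in> P j" for j B
    using * that by blast+
  define ext where "ext j B R = (SOME B'. B' \<in> P j \<and> B \<subseteq> B' \<and> R \<subseteq> closed_span B')" for j B R
  have ext: "ext j B R \<in> P j" "B \<subseteq> ext j B R" "R \<subseteq> closed_span (ext j B R)"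
    if "j \<in> A" "B \<in> P j" "|R| \<le>o |D j|" for j B R
  proof -
    have "\<exists>B'. B' \<in> P j \<and> B \<subseteq> B' \<and> R \<subseteq> closed_span B'"
      using * that by blast
    from someI_ex[OF this] show "ext j B R \<in> P j" "B \<subseteq> ext j B R" "R \<subseteq> closed_span (ext j B R)"
      unfolding ext_def by blast+
  qed
  define supp where "supp B b = (SOME C. C \<subseteq> B \<and> countable C \<and> b \<in> closed_span C)" for B b
  have supp: "supp B b \<subseteq> B" "countable (supp B b)" "b \<in> closed_span (supp B b)" if "b \<in> closed_span B" for B b
  proof -
    have "\<exists>C. C \<subseteq> B \<and> countable C \<and> b \<in> closed_span C"
      using that by (rule closed_span_countable_subset) blast
    from someI_ex[OF this] show "supp B b \<subseteq> B" "countable (supp B b)" "b \<in> closed_span (supp B b)"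
      unfolding supp_def by blast+
  qed
  \<comment> \<open>Three demands on the next round: the generators below \<open>j\<close>, so that
    the space is exhausted; the bases of earlier ladders, so that the spaces increase; and supports
    over every ladder \<open>i\<close>, so that earlier spaces become spanned by parts of later
    bases.\<close>
  define R where "R B j = underS rank j \<union> (\<Union>l\<in>A \<inter> underS rank j. B l) \<union>
      (\<Union>i\<in>A. \<Union>b\<in>B j \<inter> closed_span (B i). supp (B i) b)" for B j
  have R: "|R B j| \<le>o |D j|" if j: "j \<in> A" and B: "\<And>l. l \<in> A \<Longrightarrow> B l \<in> P l" for B j
    unfolding R_def
  proof (intro card_of_Un_ordLeq card_of_UN_ordLeq D(1))
    show "|underS rank j| \<le>o |D j|" "|A \<inter> underS rank j| \<le>o |D j|" "|A| \<le>o |D j|"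
      using D(2)[of j] by (auto intro!: card_of_mono1 simp: D_def)
    show "|B l| \<le>o |D j|" if "l \<in> A \<inter> underS rank j" for l
      using P(2)[of l "B l"] B[of l] card_of_mono1[OF D_mono[of l j]] that ordLeq_transitive by blast
    show "|B j \<inter> closed_span (B i)| \<le>o |D j|" for i
      using P(2)[OF j B[OF j]] card_of_mono1[of "B j \<inter> closed_span (B i)" "B j"] ordLeq_transitive by blast
    show "|supp (B i) b| \<le>o |D j|" if "b \<in> B j \<inter> closed_span (B i)" for i b
      using supp(2)[of b "B i"] that D(1) by (intro countable_ordLeq) auto
  qed
  define B where "B n = ((\<lambda>B j. ext j (B j) (R B j)) ^^ n) (\<lambda>j. SOME B. B \<in> P j)" for n
  have B_Suc: "B (Suc n) j = ext j (B n j) (R (B n) j)" for n j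
    by (simp add: B_def)
  have B: "B n j \<in> P j" if "j \<in> A" for n j
    using that
  proof (induction n arbitrary: j)
    case 0
    then show ?case
      using P_ne[of j] some_in_eq[of "P j"] by (simp add: B_def)
  next
    case (Suc n)
    then show ?case
      unfolding B_Suc using R ext(1) by blast
  qed
  have step: "B n j \<subseteq> B (Suc n) j" "R (B n) j \<subseteq> closed_span (B (Suc n) j)" if "j \<in> A" for n j
  proof -
    have "|R (B n) j| \<le>o |D j|"
      using R[OF that] B by blast
    from ext(2,3)[OF that B[OF that] this]
    show "B n j \<subseteq> B (Suc n) j" "R (B n) j \<subseteq> closed_span (B (Suc n) j)"
      unfolding B_Suc .
  qed
  define E where "E j = (\<Union>n. B n j)" for j
  have BE: "closed_span (B n j) \<subseteq> closed_span (E j)" for n j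
    by (rule closed_span_mono) (auto simp: E_def)
  have "\<exists>N. onb (closed_span (\<Union>i\<in>A. E i)) N"
  proof (rule onb_chain[OF r A(1)])
    fix i assume i: "i \<in> A"
    have "mono (\<lambda>n. B n i)"
      using step(1)[OF i] by (simp add: mono_iff_le_Suc)
    then have "subset.chain UNIV (range (\<lambda>n. B n i))"
      unfolding subset_chain_def by (metis UNIV_I le_cases monoD rangeE subsetI)
    then show "orthonormal (E i)"
      unfolding E_def using P(1)[OF i B[OF i]] by (intro orthonormal_Union_chain) auto
  next
    fix i j b assume ij: "i \<in> A" "j \<in> A" "j \<in> underS rank i" and "b \<in> E j"
    then obtain n where n: "b \<in> B n j"
      by (auto simp: E_def)
    then have "b \<in> R (B n) i"
      using ij by (auto simp: R_def)
    then have bi: "b \<in> closed_span (B (Suc n) i)"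
      using step(2)[OF ij(1)] by blast
    \<comment> \<open>\<open>b\<close> lies in the span of ladder \<open>i\<close> only from round
      \<open>Suc n\<close> on, so its support is taken there and reaches the span of ladder
      \<open>j\<close> one round later.\<close>
    have "b \<in> B (Suc n) j"
      using n step(1)[OF ij(2)] by blast
    then have "supp (B (Suc n) i) b \<subseteq> R (B (Suc n)) j"
      using bi ij(1) unfolding R_def by blast
    then have "supp (B (Suc n) i) b \<subseteq> closed_span (E j)"
      using step(2)[OF ij(2), of "Suc n"] BE by blast
    moreover have "supp (B (Suc n) i) b \<subseteq> E i"
      using supp(1)[OF bi] by (auto simp: E_def)
    ultimately show "b \<in> closed_span (E i \<inter> closed_span (E j))"
      using supp(3)[OF bi] closed_span_mono[of "supp (B (Suc n) i) b" "E i \<inter> closed_span (E j)"] by blast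
  qed
  moreover have "?X \<subseteq> closed_span (\<Union>i\<in>A. E i)"
  proof
    fix a assume "a \<in> ?X"
    then obtain i where i: "i \<in> A" "a \<in> underS rank i"
      using cofinal by blast
    then have "a \<in> closed_span (E i)"
      using step(2)[OF i(1), of 0] BE by (auto simp: R_def)
    moreover have "closed_span (E i) \<subseteq> closed_span (\<Union>i\<in>A. E i)"
      using i(1) by (intro closed_span_mono) blast
    ultimately show "a \<in> closed_span (\<Union>i\<in>A. E i)" by blast
  qed
  then have "closed_span (\<Union>i\<in>A. E i) = UNIV"
    using closed_span_subsetI span_X by blast
  ultimately show ?thesis by simp
qed

lemma free_imp_almost_free:
  assumes free
  shows almost_free
  unfolding almost_free_def cardinal_free_def
  using assms free_subspace_closed_subspace[of UNIV] unfolding free_def by simp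

lemma almost_free_imp_free:
  assumes card: "|UNIV :: 'v set| =o rank" and compact: "strongly_compact (lambda_field TYPE('k)) rank"
    and af: almost_free
  shows free
proof -
  have unc: "natLeq <o rank"
    using compact ordLess_ordLeq_trans unfolding strongly_compact_def by blast
  show ?thesis
    unfolding free_iff
  proof (cases "regularCard rank")
    case False
    then show "\<exists>B. onb UNIV B" using almost_free_singular unc af by blast
  next
    case reg: True
    show "\<exists>B. onb UNIV B"
    proof (cases "\<exists>c :: 'k. 0 < val c \<and> val c < 1")
      case True
      then show ?thesis using almost_free_regular[OF card compact reg af] by blast
    next
      case False
      show ?thesis
      proof (rule trivially_valued_free)
        \<comment> \<open>No value lies strictly between 0 and 1; applied to inverses, this excludes
          values above 1 as well.\<close>
        fix c :: 'k assume "c \<noteq> 0"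
        then have c: "0 < val c"
          using val_ge_0[of c] val_eq_0_iff[of c] by linarith
        have *: "\<not> (0 < val d \<and> val d < 1)" for d :: 'k
          using False by blast
        have "1 \<le> val c" "1 \<le> inverse (val c)"
          using c *[of c] *[of "inverse c"] by (simp_all add: val_inverse not_less)
        then show "val c = 1"
          using c by (simp add: field_simps)
      next
        fix v :: 'v
        have "|{v}| \<le>o natLeq"
          using countable_ordLeq[of "{v}" "UNIV :: nat set"] card_of_nat ordLeq_ordIso_trans by blast
        then have "|{v}| <o rank"
          using unc ordLeq_ordLess_trans by blast
        then show "\<exists>B. onb (closed_span {v}) B"
          using cardinal_freeD af unfolding almost_free_def by blast
      qed
    qed
  qed
qed

end

theorem theorem5p1:
  fixes scale :: "'k :: complete_valuation_field \<Rightarrow> 'v \<Rightarrow> 'v :: {ab_group_add, complete_space}"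
    and nrm :: "'v \<Rightarrow> real"
  assumes "banach_vector_space scale nrm"
    and "|UNIV :: 'v set| =o banach_vector_space.rank scale"
    and "strongly_compact (lambda_field TYPE('k)) (banach_vector_space.rank scale)"
  shows "banach_vector_space.free scale nrm \<longleftrightarrow> banach_vector_space.almost_free scale nrm"
proof -
  interpret banach_vector_space scale nrm by (rule assms)
  show ?thesis
    using almost_free_imp_free free_imp_almost_free assms(2,3) by blast
qed

end
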